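(* Under the setting of the context, consider the relaxed MPC problem $\hat J_N^*(x;\delta)=\min_{\mathbf u}\sum_{k=0}^{N-1}\hat\ell(x_k,u_k)+\hat F(x_N)$ subject to $x_0=x$, $x_{k+1}=Ax_k+Bu_k$, with $\hat F(x)=x^\top Px+\varepsilon\hat B_f(x)$. For any compact set $\mathcal{X}_0\subseteq\mathcal{X}_N^\circ$ there exists $\bar\delta_0>0$ such that for any admissible relaxation parameter $\delta\le\bar\delta_0$ and any $x(0)\in\mathcal{X}_0$ the feedback $u(k)=\hat u_0^*(x(k))$ asymptotically stabilizes the origin of $x(k+1)=Ax(k)+Bu(k)$ under strict satisfaction of all input and state constraints.
   Context: System $x(k+1)=Ax(k)+Bu(k)$, $(A,B)$ stabilizable. Polytopes $\mathcal{X}=\{x:C_xx\le d_x\}$, $\mathcal{U}=\{u:C_uu\le d_u\}$ (compact), $d_x,d_u$ entrywise strictly positive; $C^i$ row $i$, $d^i$ entry $i$. Stage cost $\ell(x,u)=x^\top Qx+u^\top Ru$, $Q\succeq0$, $R\succ0$; horizon $N\ge1$; $\varepsilon>0$. Relaxed barrier with parameter $\delta\in(0,1]$: relaxing function $\beta(\cdot;\delta)$ is $\beta_k(z;\delta)=\frac{k-1}{k}[(\frac{z-k\delta}{(k-1)\delta})^k-1]-\ln\delta$ ($k\ge2$ even) or $\beta_e(z;\delta)=\exp(1-z/\delta)-1-\ln\delta$; $\hat B(z)=-\ln z$ if $z>\delta$, $\beta(z;\delta)$ if $z\le\delta$. With $z_x^i(x)=-C_x^ix+d_x^i$, $\hat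 B_x=\sum_i\hat B_{x,i}$, where either $\hat B_{x,i}(x)=\hat B(z_x^i(x))+\ln d_x^i-C_x^ix/d_x^i$ (gradient recentering) or $\hat B_{x,i}(x)=(1+w_x^i)(\hat B(z_x^i(x))+\ln d_x^i)$ with $w_x\ge0$, $\sum_i(1+w_x^i)(C_x^i)^\top/d_x^i=0$ (weight recentering); $\hat B_u$ analogously. "Admissible" $\delta$ means $\hat B_x(0)=\hat B_u(0)=0$ and $\nabla\hat B_x(0)=\nabla\hat B_u(0)=0$. Nonrelaxed $B_x,B_u$: same formulas with $\hat B(z)$ replaced by $-\ln z$ (on the interiors). $\hat\ell(x,u)=\ell(x,u)+\varepsilon\hat B_u(u)+\varepsilon\hat B_x(x)$. Ingredients: $K$ with $A_K=A+BK$ Schur; $\mathcal{X}_K=\{x\in\mathcal{X}:Kx\in\mathcal{U}\}$, $B_K(x)=B_x(x)+B_u(Kx)$; $M\succeq0$ and convex compact $\mathcal{N}\subset\mathcal{X}_K$ with $0\in\mathcal{N}^\circ$ such that $B_K(x)\le x^\top Mx$ on $\mathcal{N}$; $P\succ0$ with $P=A_K^\top PA_K+K^\top RK+Q+\varepsilon M$; terminal set $\mathcal{X}_f=\{x:\varphi(x)\le1\}$ convex compact, $0\in\mathcal{X}_f\subset\mathcal{N}$, $A_K\mathcal{X}_f\subseteq\mathcal{X}_f$, where $\varphi$ is continuously differentiable, convex, positive definite with $\varphi(A_Kx)\le\varphi(x)$ on $\mathcal{X}_f$; a recentered barrier $B_f:\mathcal{X}_f^\circ\to\mathbb{R}_{\ge0}$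 (convex, $B_f(0)=0$, $\to\infty$ at boundary) with $B_f(A_Kx)\le B_f(x)$ on $\mathcal{X}_f^\circ$. The relaxed terminal barrier is $\hat B_f(x)=\hat B(1-\varphi(x))$. Feasible set: $\mathcal{X}_N=\{x\in\mathcal{X}:\exists\,\mathbf u$ with $u_k\in\mathcal{U}$, $x_k\in\mathcal{X}$, $k=0,\dots,N-1$, $x_N\in\mathcal{X}_f\}$ (predicted states from $x_0=x$). *)

theory Defs
  imports "HOL-Analysis.Analysis"
begin

section \<open>Linear-algebra notions\<close>

text \<open>Schur stability: every (complex) eigenvalue lies in the open unit disc.\<close>
definition schur :: "real^'n^'n \<Rightarrow> bool" where
  "schur A \<longleftrightarrow>
     (\<forall>(l::complex) (v::complex^'n). v \<noteq> 0 \<and>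
        (\<chi> i j. complex_of_real (A $ i $ j)) *v v = l *s v \<longrightarrow> cmod l < 1)"

definition stabilizable :: "real^'n^'n \<Rightarrow> real^'m^'n \<Rightarrow> bool" where
  "stabilizable A B \<longleftrightarrow> (\<exists>K::real^'n^'m. schur (A + B ** K))"

definition psd :: "real^'n^'n \<Rightarrow> bool" where
  "psd Q \<longleftrightarrow> transpose Q = Q \<and> (\<forall>x. 0 \<le> x \<bullet> (Q *v x))"

definition pd :: "real^'n^'n \<Rightarrow> bool" where
  "pd Q \<longleftrightarrow> transpose Q = Q \<and> (\<forall>x. x \<noteq> 0 \<longrightarrow> 0 < x \<bullet> (Q *v x))"

definition qf :: "real^'n^'n \<Rightarrow> real^'n \<Rightarrow> real" where
  "qf Q x = x \<bullet> (Q *v x)"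

text \<open>Polytope \<open>{x. C x \<le> d}\<close>; row i of C is \<open>C $ i\<close>.\<close>
definition polytope_set :: "real^'n^'p \<Rightarrow> real^'p \<Rightarrow> (real^'n) set" where
  "polytope_set C d = {x. \<forall>i. (C $ i) \<bullet> x \<le> d $ i}"

definition strictly_in :: "real^'n^'p \<Rightarrow> real^'p \<Rightarrow> real^'n \<Rightarrow> bool" where
  "strictly_in C d x \<longleftrightarrow> (\<forall>i. (C $ i) \<bullet> x < d $ i)"

section \<open>Relaxed barrier functions\<close>

text \<open>Choice of relaxing function: polynomial of even order k, or exponential.\<close>
datatype relax_kind = PolyRelax nat | ExpRelax

definition valid_relax :: "relax_kind \<Rightarrow> bool" where
  "valid_relax r \<longleftrightarrow> (case r of PolyRelax k \<Rightarrow> 2 \<le> k \<and> even k | ExpRelax \<Rightarrow> True)"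

definition beta :: "relax_kind \<Rightarrow> real \<Rightarrow> real \<Rightarrow> real" where
  "beta r \<delta> z = (case r of
      PolyRelax k \<Rightarrow> (real k - 1) / real k *
          (((z - real k * \<delta>) / ((real k - 1) * \<delta>)) ^ k - 1) - ln \<delta>
    | ExpRelax \<Rightarrow> exp (1 - z / \<delta>) - 1 - ln \<delta>)"

definition Bhat :: "relax_kind \<Rightarrow> real \<Rightarrow> real \<Rightarrow> real" where
  "Bhat r \<delta> z = (if z > \<delta> then - ln z else beta r \<delta> z)"

text \<open>Recentering: gradient recentering, or weight recentering with weight vector w.\<close>
datatype 'p recenter = GradRecenter | WeightRecenter "real^'p"

definition valid_recenter :: "real^'n^'p \<Rightarrow> real^'p \<Rightarrow> 'p recenter \<Rightarrow> bool" where
  "valid_recenter C d rc \<longleftrightarrow> (case rc of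
      GradRecenter \<Rightarrow> True
    | WeightRecenter w \<Rightarrow> (\<forall>i. 0 \<le> w $ i) \<and>
         (\<Sum>i\<in>UNIV. ((1 + w $ i) / d $ i) *\<^sub>R (C $ i)) = 0)"

text \<open>Generic recentered barrier built from a scalar barrier \<open>b\<close> (either the
  relaxed \<open>Bhat r \<delta>\<close> or the logarithmic \<open>\<lambda>z. - ln z\<close>).\<close>
definition rbarrier :: "(real \<Rightarrow> real) \<Rightarrow> real^'n^'p \<Rightarrow> real^'p \<Rightarrow> 'p recenter \<Rightarrow> real^'n \<Rightarrow> real" where
  "rbarrier b C d rc x = (\<Sum>i\<in>UNIV.
      (case rc of
         GradRecenter \<Rightarrow> b (d $ i - (C $ i) \<bullet> x) + ln (d $ i) - ((C $ i) \<bullet> x) / d $ i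
       | WeightRecenter w \<Rightarrow> (1 + w $ i) * (b (d $ i - (C $ i) \<bullet> x) + ln (d $ i))))"

text \<open>Relaxed recentered barrier \<open>\<hat>B\<close>.\<close>
definition relaxed_barrier :: "relax_kind \<Rightarrow> real \<Rightarrow> real^'n^'p \<Rightarrow> real^'p \<Rightarrow> 'p recenter \<Rightarrow> real^'n \<Rightarrow> real" where
  "relaxed_barrier r \<delta> C d rc = rbarrier (Bhat r \<delta>) C d rc"

text \<open>Nonrelaxed recentered barrier (meaningful on the interior of the polytope).\<close>
definition log_barrier :: "real^'n^'p \<Rightarrow> real^'p \<Rightarrow> 'p recenter \<Rightarrow> real^'n \<Rightarrow> real" where
  "log_barrier C d rc = rbarrier (\<lambda>z. - ln z) C d rc"

text \<open>Admissible relaxation parameter.\<close>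
definition admissible ::
  "relax_kind \<Rightarrow> real^'n^'p \<Rightarrow> real^'p \<Rightarrow> 'p recenter \<Rightarrow>
   real^'m^'q \<Rightarrow> real^'q \<Rightarrow> 'q recenter \<Rightarrow> real \<Rightarrow> bool" where
  "admissible r Cx dx rcx Cu du rcu \<delta> \<longleftrightarrow>
     0 < \<delta> \<and> \<delta> \<le> 1 \<and>
     relaxed_barrier r \<delta> Cx dx rcx 0 = 0 \<and> relaxed_barrier r \<delta> Cu du rcu 0 = 0 \<and>
     (relaxed_barrier r \<delta> Cx dx rcx has_derivative (\<lambda>h. 0)) (at 0) \<and>
     (relaxed_barrier r \<delta> Cu du rcu has_derivative (\<lambda>h. 0)) (at 0)"

section \<open>Predictions, feasible set, MPC cost\<close>

fun pred :: "real^'n^'n \<Rightarrow> real^'m^'n \<Rightarrow> real^'n \<Rightarrow> (nat \<Rightarrow> real^'m) \<Rightarrow> nat \<Rightarrow> real^'n" where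
  "pred A B x u 0 = x"
| "pred A B x u (Suc k) = A *v pred A B x u k + B *v u k"

definition feasible_set ::
  "real^'n^'n \<Rightarrow> real^'m^'n \<Rightarrow> (real^'n) set \<Rightarrow> (real^'m) set \<Rightarrow> (real^'n) set \<Rightarrow> nat \<Rightarrow> (real^'n) set" where
  "feasible_set A B X U Xf N = {x \<in> X. \<exists>u. (\<forall>k<N. u k \<in> U \<and> pred A B x u k \<in> X) \<and> pred A B x u N \<in> Xf}"

text \<open>Relaxed MPC cost \<open>\<hat>J_N(x,u;\<delta>)\<close> with stage cost
  \<open>\<ell> + \<epsilon> \<hat>B_u + \<epsilon> \<hat>B_x\<close> and terminal cost \<open>x'Px + \<epsilon> \<hat>B(1 - \<phi> x)\<close>.\<close>
definition relaxed_cost ::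
  "real^'n^'n \<Rightarrow> real^'m^'n \<Rightarrow> real^'n^'n \<Rightarrow> real^'m^'m \<Rightarrow> real \<Rightarrow> nat \<Rightarrow>
   relax_kind \<Rightarrow> real \<Rightarrow>
   real^'n^'p \<Rightarrow> real^'p \<Rightarrow> 'p recenter \<Rightarrow> real^'m^'q \<Rightarrow> real^'q \<Rightarrow> 'q recenter \<Rightarrow>
   real^'n^'n \<Rightarrow> (real^'n \<Rightarrow> real) \<Rightarrow> real^'n \<Rightarrow> (nat \<Rightarrow> real^'m) \<Rightarrow> real" where
  "relaxed_cost A B Q R \<epsilon> N r \<delta> Cx dx rcx Cu du rcu P \<phi> x u =
     (\<Sum>k<N. qf Q (pred A B x u k) + qf R (u k)
              + \<epsilon> * relaxed_barrier r \<delta> Cu du rcu (u k)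
              + \<epsilon> * relaxed_barrier r \<delta> Cx dx rcx (pred A B x u k))
     + qf P (pred A B x u N) + \<epsilon> * Bhat r \<delta> (1 - \<phi> (pred A B x u N))"

text \<open>Closed loop under the relaxed MPC feedback: at each time the applied input
  is the first element of an optimal input sequence for the current state.\<close>
definition closed_loop ::
  "real^'n^'n \<Rightarrow> real^'m^'n \<Rightarrow> (real^'n \<Rightarrow> (nat \<Rightarrow> real^'m) \<Rightarrow> real) \<Rightarrow>
   (nat \<Rightarrow> real^'n) \<Rightarrow> (nat \<Rightarrow> nat \<Rightarrow> real^'m) \<Rightarrow> bool" where
  "closed_loop A B J xs us \<longleftrightarrow>
     (\<forall>k. (\<forall>v. J (xs k) (us k) \<le> J (xs k) v) \<and>
          xs (Suc k) = A *v xs k + B *v us k 0)"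

end

theory Submission
  imports Defs "Jordan_Normal_Form.Spectral_Radius"
begin

text \<open>
  Call \<open>\<epsilon> (- ln \<delta> + c)\<close> the unrelaxed level, for a constant \<open>c\<close> depending only on the
  constraints: below it every predicted constraint slack exceeds \<open>\<delta>\<close>, so along such predictions
  the relaxed barriers are the logarithmic ones. On the terminal set the Lyapunov equation for \<open>P\<close>
  and the bound by \<open>M\<close> make the terminal cost a control Lyapunov function for \<open>K\<close>, so the shifted
  optimal input sequence shows that the optimal cost decreases along the closed loop by at least
  the stage cost. Hence a closed loop that starts below the level stays below it and satisfies all
  constraints strictly. For compact \<open>X0\<close> in the interior of the feasible set, shrinking feasible
  input sequences bounds the optimal cost on \<open>X0\<close> independently of \<open>\<delta>\<close>, and \<open>- ln \<delta> \<rightarrow> \<infinity>\<close>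
  lifts the level above this bound for small \<open>\<delta>\<close>.

  For convergence, the decreasing cost converges; since the cost is strongly convex in the inputs
  (\<open>R\<close> is positive definite), consecutive optimal input sequences eventually agree with the shifted
  ones. The predicted terminal states are then a vanishing perturbation of the Schur-stable
  dynamics \<open>A + B K\<close> and tend to \<open>0\<close>, and so do the states. Near the origin the optimal cost is
  bounded by the terminal cost, which gives Lyapunov stability.
\<close>

no_notation vec_index (infixl \<open>$\<close> 100)
no_notation scalar_prod (infix \<open>\<bullet>\<close> 70)

section \<open>Exponential decay of Schur-stable matrices\<close>

definition complex_mat_of :: "(nat \<Rightarrow> 'n::finite) \<Rightarrow> real^'n^'n \<Rightarrow> complex mat" where
  "complex_mat_of e M = mat CARD('n) CARD('n) (\<lambda>(i,j). complex_of_real (M $ e i $ e j))"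

lemma complex_mat_of_carrier: "complex_mat_of e M \<in> carrier_mat CARD('n) CARD('n)"
  for M :: "real^'n::finite^'n"
  by (simp add: complex_mat_of_def)

lemma complex_mat_of_scaleR:
  "complex_mat_of e (c *\<^sub>R M) = complex_of_real c \<cdot>\<^sub>m complex_mat_of e M"
  by (rule eq_matI) (auto simp: complex_mat_of_def)

lemma eigenvalue_smult_mat:
  assumes A: "A \<in> carrier_mat n n" and l: "eigenvalue A l"
  shows "eigenvalue (a \<cdot>\<^sub>m A) (a * l)"
proof -
  obtain v where v: "v \<in> carrier_vec n" "v \<noteq> 0\<^sub>v n" "A *\<^sub>v v = l \<cdot>\<^sub>v v"
    using l A by (auto simp: eigenvalue_def eigenvector_def)
  have "(a \<cdot>\<^sub>m A) *\<^sub>v v = a \<cdot>\<^sub>v (A *\<^sub>v v)"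
    using A v(1) by (intro eq_vecI) (auto simp: scalar_prod_def sum_distrib_left ac_simps)
  with v A show ?thesis by (auto simp: eigenvalue_def eigenvector_def smult_smult_assoc)
qed

lemma spectral_radius_smult_mat:
  assumes A: "A \<in> carrier_mat n n" and n: "0 < n" and a: "a \<noteq> 0"
  shows "spectral_radius (a \<cdot>\<^sub>m A) \<le> cmod a * spectral_radius A"
proof -
  have aA: "a \<cdot>\<^sub>m A \<in> carrier_mat n n" using A by simp
  obtain l where l: "eigenvalue (a \<cdot>\<^sub>m A) l" "spectral_radius (a \<cdot>\<^sub>m A) = cmod l"
    using spectral_radius_mem_max(1)[OF aA n] by (auto simp: spectrum_def)
  have "inverse a \<cdot>\<^sub>m (a \<cdot>\<^sub>m A) = A"
    using A a by (intro eq_matI) auto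
  hence "eigenvalue A (inverse a * l)"
    using eigenvalue_smult_mat[OF aA l(1), of "inverse a"] by simp
  hence "cmod (inverse a * l) \<le> spectral_radius A"
    using spectral_radius_mem_max(2)[OF A n] by (auto simp: spectrum_def)
  hence "cmod l / cmod a \<le> spectral_radius A" by (simp add: norm_mult norm_inverse divide_inverse mult.commute)
  thus ?thesis using a l(2) by (simp add: pos_divide_le_eq mult.commute)
qed

lemma eigenvector_complex_mat_of:
  fixes M :: "real^'n::finite^'n"
  assumes e: "bij_betw e {..<CARD('n)} (UNIV::'n set)"
    and ev: "eigenvector (complex_mat_of e M) v l"
  shows "\<exists>w::complex^'n. w \<noteq> 0 \<and> (\<chi> i j. complex_of_real (M $ i $ j)) *v w = l *s w"
proof -
  let ?n = "CARD('n)"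
  define ei where "ei = inv_into {..<?n} e"
  have ei: "\<And>i. ei i < ?n" "\<And>i. e (ei i) = i" using e unfolding ei_def
    by (metis UNIV_I bij_betw_def inv_into_into lessThan_iff, metis UNIV_I bij_betw_def f_inv_into_f)
  have eie: "\<And>l. l < ?n \<Longrightarrow> ei (e l) = l" using e unfolding ei_def
    by (auto simp: bij_betw_def inv_into_f_f)
  from ev have vc: "v \<in> carrier_vec ?n" and vnz: "v \<noteq> 0\<^sub>v ?n"
    and eq: "complex_mat_of e M *\<^sub>v v = l \<cdot>\<^sub>v v"
    by (auto simp: eigenvector_def complex_mat_of_def)
  define w :: "complex^'n" where "w = (\<chi> i. vec_index v (ei i))"
  have "w \<noteq> 0"
  proof
    assume "w = 0"
    hence "\<And>i. vec_index v (ei i) = 0" unfolding w_def by (metis vec_lambda_beta zero_index)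
    hence "\<And>j. j < ?n \<Longrightarrow> vec_index v j = 0" by (metis eie)
    with vc vnz show False by auto
  qed
  moreover have "(\<chi> i j. complex_of_real (M $ i $ j)) *v w = l *s w"
  proof (rule iffD2[OF Finite_Cartesian_Product.vec_eq_iff], rule allI)
    fix i
    have "((\<chi> i j. complex_of_real (M $ i $ j)) *v w) $ i
        = (\<Sum>j\<in>UNIV. complex_of_real (M $ i $ j) * w $ j)"
      by (simp add: matrix_vector_mult_def)
    also have "\<dots> = (\<Sum>j<?n. complex_of_real (M $ i $ e j) * vec_index v (ei (e j)))"
      unfolding w_def by (simp add: sum.reindex_bij_betw[OF e, symmetric])
    also have "\<dots> = (\<Sum>j<?n. complex_of_real (M $ e (ei i) $ e j) * vec_index v j)"
      by (rule sum.cong) (auto simp: eie ei)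
    also have "\<dots> = vec_index (complex_mat_of e M *\<^sub>v v) (ei i)"
      using ei vc by (simp add: complex_mat_of_def scalar_prod_def row_def lessThan_atLeast0)
    also have "\<dots> = l * vec_index v (ei i)" using eq ei vc by simp
    also have "\<dots> = (l *s w) $ i" by (simp add: w_def)
    finally show "((\<chi> i j. complex_of_real (M $ i $ j)) *v w) $ i = (l *s w) $ i" .
  qed
  ultimately show ?thesis by blast
qed

lemma schur_spectral_radius_less_1:
  fixes M :: "real^'n::finite^'n"
  assumes e: "bij_betw e {..<CARD('n)} (UNIV::'n set)" and M: "schur M"
  shows "spectral_radius (complex_mat_of e M) < 1"
proof -
  obtain l where l: "eigenvalue (complex_mat_of e M) l"
      "spectral_radius (complex_mat_of e M) = cmod l"
    using spectral_radius_mem_max(1)[OF complex_mat_of_carrier, of e M] by (auto simp: spectrum_def)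
  then obtain v where "eigenvector (complex_mat_of e M) v l" unfolding eigenvalue_def by blast
  from eigenvector_complex_mat_of[OF e this] M have "cmod l < 1" unfolding schur_def by blast
  with l(2) show ?thesis by simp
qed

lemma funpow_matrix_vector_complex_mat_of:
  fixes M :: "real^'n::finite^'n"
  assumes e: "bij_betw e {..<CARD('n)} (UNIV::'n set)" and i: "i < CARD('n)"
  shows "complex_of_real ((((*v) M) ^^ k) x $ e i)
     = (\<Sum>j<CARD('n). (complex_mat_of e M ^\<^sub>m k) $$ (i,j) * complex_of_real (x $ e j))"
  using i
proof (induction k arbitrary: x i)
  case 0
  have "(\<Sum>j<CARD('n). (complex_mat_of e M ^\<^sub>m 0) $$ (i,j) * complex_of_real (x $ e j))
      = (\<Sum>j<CARD('n). (if i = j then complex_of_real (x $ e j) else 0))"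
    by (rule sum.cong) (use 0 in \<open>auto simp: complex_mat_of_def\<close>)
  also have "\<dots> = complex_of_real (x $ e i)" using 0 by simp
  finally show ?case by simp
next
  case (Suc k)
  let ?n = "CARD('n)"
  let ?C = "complex_mat_of e M"
  have C: "?C \<in> carrier_mat ?n ?n" by (rule complex_mat_of_carrier)
  have step: "complex_of_real ((M *v x) $ e l) = (\<Sum>j<?n. ?C $$ (l,j) * complex_of_real (x $ e j))"
    if l: "l < ?n" for l
  proof -
    have "(M *v x) $ e l = (\<Sum>j\<in>UNIV. M $ e l $ j * x $ j)"
      by (simp add: matrix_vector_mult_def)
    also have "\<dots> = (\<Sum>j<?n. M $ e l $ e j * x $ e j)"
      by (simp add: sum.reindex_bij_betw[OF e, symmetric])
    finally show ?thesis using l by (simp add: complex_mat_of_def)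
  qed
  have "complex_of_real ((((*v) M) ^^ Suc k) x $ e i)
      = complex_of_real ((((*v) M) ^^ k) (M *v x) $ e i)"
    by (simp only: funpow_Suc_right comp_def)
  also have "\<dots> = (\<Sum>l<?n. (?C ^\<^sub>m k) $$ (i,l) * complex_of_real ((M *v x) $ e l))"
    using Suc by simp
  also have "\<dots> = (\<Sum>l<?n. (?C ^\<^sub>m k) $$ (i,l) * (\<Sum>j<?n. ?C $$ (l,j) * complex_of_real (x $ e j)))"
    by (rule sum.cong) (auto simp: step)
  also have "\<dots> = (\<Sum>j<?n. (\<Sum>l<?n. (?C ^\<^sub>m k) $$ (i,l) * ?C $$ (l,j)) * complex_of_real (x $ e j))"
    unfolding sum_distrib_left sum_distrib_right mult.assoc by (rule sum.swap)
  also have "\<dots> = (\<Sum>j<?n. (?C ^\<^sub>m Suc k) $$ (i,j) * complex_of_real (x $ e j))"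
  proof (rule sum.cong)
    fix j assume "j \<in> {..<?n}"
    moreover have "?C ^\<^sub>m k \<in> carrier_mat ?n ?n" using C by simp
    ultimately have "(?C ^\<^sub>m Suc k) $$ (i,j) = (\<Sum>l<?n. (?C ^\<^sub>m k) $$ (i,l) * ?C $$ (l,j))"
      using Suc.prems C by (simp add: scalar_prod_def lessThan_atLeast0)
    thus "(\<Sum>l<?n. (?C ^\<^sub>m k) $$ (i,l) * ?C $$ (l,j)) * complex_of_real (x $ e j)
        = (?C ^\<^sub>m Suc k) $$ (i,j) * complex_of_real (x $ e j)" by simp
  qed simp
  finally show ?case .
qed

lemma norm_funpow_matrix_vector_le_norm_bound:
  fixes M :: "real^'n::finite^'n"
  assumes e: "bij_betw e {..<CARD('n)} (UNIV::'n set)"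
    and bound: "norm_bound (complex_mat_of e M ^\<^sub>m k) c"
  shows "norm ((((*v) M) ^^ k) x) \<le> real CARD('n) * real CARD('n) * c * norm x"
proof -
  let ?n = "CARD('n)"
  let ?y = "(((*v) M) ^^ k) x"
  have entry: "\<bar>?y $ e i\<bar> \<le> real ?n * c * norm x" if i: "i < ?n" for i
  proof -
    have "\<bar>?y $ e i\<bar> = cmod (\<Sum>j<?n. (complex_mat_of e M ^\<^sub>m k) $$ (i,j) * complex_of_real (x $ e j))"
      using funpow_matrix_vector_complex_mat_of[OF e i] by (metis norm_of_real)
    also have "\<dots> \<le> (\<Sum>j<?n. cmod ((complex_mat_of e M ^\<^sub>m k) $$ (i,j)) * norm x)"
      by (rule order_trans[OF norm_sum sum_mono])
        (auto simp: norm_mult intro!: mult_left_mono component_le_norm_cart)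
    also have "\<dots> \<le> (\<Sum>j<?n. c * norm x)"
      using bound i complex_mat_of_carrier[of e M]
      by (intro sum_mono mult_right_mono) (auto simp: norm_bound_def)
    finally show ?thesis by simp
  qed
  have "norm ?y \<le> (\<Sum>i\<in>UNIV. \<bar>?y $ i\<bar>)" by (rule norm_le_l1_cart)
  also have "\<dots> = (\<Sum>i<?n. \<bar>?y $ e i\<bar>)" by (simp add: sum.reindex_bij_betw[OF e, symmetric])
  also have "\<dots> \<le> (\<Sum>i<?n. real ?n * c * norm x)" by (rule sum_mono) (use entry in auto)
  finally show ?thesis by simp
qed

lemma funpow_matrix_vector_scaleR:
  "(((*v) (a *\<^sub>R M)) ^^ k) x = a ^ k *\<^sub>R (((*v) M) ^^ k) x" for M :: "real^'n::finite^'n"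
  by (induction k) (simp_all add: scaleR_matrix_vector_assoc matrix_vector_mult_scaleR mult.commute)

theorem schur_imp_exp_decay:
  fixes M :: "real^'n::finite^'n"
  assumes "schur M"
  shows "\<exists>c \<rho>. 0 \<le> c \<and> 0 < \<rho> \<and> \<rho> < 1 \<and> (\<forall>k x. norm ((((*v) M) ^^ k) x) \<le> c * \<rho> ^ k * norm x)"
proof -
  let ?n = "CARD('n)"
  obtain e where e: "bij_betw e {..<?n} (UNIV::'n set)"
    using ex_bij_betw_nat_finite[of "UNIV::'n set"] by (auto simp: lessThan_atLeast0)
  define s where "s = spectral_radius (complex_mat_of e M)"
  have s: "s < 1" using schur_spectral_radius_less_1[OF e assms] by (simp add: s_def)
  have "0 \<le> s"
    using spectral_radius_mem_max(1)[OF complex_mat_of_carrier, of e M] by (auto simp: s_def)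
  define \<rho> where "\<rho> = (1 + s) / 2"
  have \<rho>: "0 < \<rho>" "\<rho> < 1" "s < \<rho>" using \<open>0 \<le> s\<close> s by (auto simp: \<rho>_def)
  \<comment> \<open>The powers of \<open>M / \<rho>\<close> are bounded because its spectral radius is \<open>s / \<rho> < 1\<close>.\<close>
  have "spectral_radius (complex_mat_of e ((1 / \<rho>) *\<^sub>R M)) \<le> (1 / \<rho>) * s"
    using spectral_radius_smult_mat[OF complex_mat_of_carrier, of "complex_of_real (1 / \<rho>)" e M] \<rho>
    by (simp add: complex_mat_of_scaleR s_def norm_divide)
  also have "\<dots> < 1" using \<rho> by (simp add: field_simps)
  finally obtain c where c: "\<And>k. norm_bound (complex_mat_of e ((1 / \<rho>) *\<^sub>R M) ^\<^sub>m k) c"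
    using spectral_radius_jnf_norm_bound_less_1_upper_triangular[OF complex_mat_of_carrier] by blast
  have "norm ((((*v) M) ^^ k) x) \<le> max 0 (real ?n * real ?n * c) * \<rho> ^ k * norm x" for k x
  proof -
    have "M = \<rho> *\<^sub>R ((1 / \<rho>) *\<^sub>R M)" using \<rho> by simp
    hence "norm ((((*v) M) ^^ k) x) = \<rho> ^ k * norm ((((*v) ((1 / \<rho>) *\<^sub>R M)) ^^ k) x)"
      using \<rho> by (metis funpow_matrix_vector_scaleR norm_scaleR abs_of_pos zero_less_power)
    also have "\<dots> \<le> \<rho> ^ k * (max 0 (real ?n * real ?n * c) * norm x)"
    proof (rule mult_left_mono)
      have "real ?n * real ?n * c * norm x \<le> max 0 (real ?n * real ?n * c) * norm x"
        by (intro mult_right_mono) auto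
      with norm_funpow_matrix_vector_le_norm_bound[OF e c]
      show "norm ((((*v) ((1 / \<rho>) *\<^sub>R M)) ^^ k) x) \<le> max 0 (real ?n * real ?n * c) * norm x"
        by (rule order_trans)
    qed (use \<rho> in simp)
    finally show ?thesis by (simp add: algebra_simps)
  qed
  moreover have "0 \<le> max 0 (real ?n * real ?n * c)" by simp
  ultimately show ?thesis using \<rho> by blast
qed

section \<open>The relaxed logarithmic barrier\<close>

lemma tangent_le_of_mono_derivative:
  fixes f f' :: "real \<Rightarrow> real"
  assumes der: "\<And>x. (f has_real_derivative f' x) (at x)"
    and mono: "\<And>x y. x \<le> y \<Longrightarrow> f' x \<le> f' y"
  shows "f p + f' p * (z - p) \<le> f z"
proof (cases z p rule: linorder_cases)
  case less
  from MVT2[OF less, of f f'] der obtain w where w: "z < w" "w < p" "f p - f z = (p - z) * f' w"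
    by blast
  have "(p - z) * f' w \<le> (p - z) * f' p" using less mono w by (intro mult_left_mono) auto
  thus ?thesis using w by (simp add: algebra_simps)
next
  case greater
  from MVT2[OF greater, of f f'] der obtain w where w: "p < w" "w < z" "f z - f p = (z - p) * f' w"
    by blast
  have "(z - p) * f' p \<le> (z - p) * f' w" using greater mono w by (intro mult_left_mono) auto
  thus ?thesis using w by (simp add: algebra_simps)
qed simp

definition dbeta :: "relax_kind \<Rightarrow> real \<Rightarrow> real \<Rightarrow> real" where
  "dbeta r \<delta> z = (case r of
      PolyRelax k \<Rightarrow> ((z - real k * \<delta>) / ((real k - 1) * \<delta>)) ^ (k - 1) / \<delta>
    | ExpRelax \<Rightarrow> - exp (1 - z / \<delta>) / \<delta>)"

lemma has_real_derivative_beta: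
  assumes "valid_relax r" "0 < \<delta>"
  shows "(beta r \<delta> has_real_derivative dbeta r \<delta> z) (at z)"
proof (cases r)
  case (PolyRelax k)
  with assms have k: "2 \<le> k" "real k - 1 \<noteq> 0" by (auto simp: valid_relax_def)
  have "((\<lambda>z. (real k - 1) / real k * (((z - real k * \<delta>) / ((real k - 1) * \<delta>)) ^ k - 1) - ln \<delta>)
     has_real_derivative (real k - 1) / real k * (real k * ((z - real k * \<delta>) / ((real k - 1) * \<delta>)) ^ (k - 1)
       * (1 / ((real k - 1) * \<delta>)))) (at z)"
    using assms k by (auto intro!: derivative_eq_intros)
  moreover have "(real k - 1) / real k * (real k * ((z - real k * \<delta>) / ((real k - 1) * \<delta>)) ^ (k - 1)
      * (1 / ((real k - 1) * \<delta>))) = ((z - real k * \<delta>) / ((real k - 1) * \<delta>)) ^ (k - 1) / \<delta>"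
    using k assms by (simp add: field_simps)
  ultimately show ?thesis using PolyRelax by (simp add: beta_def[abs_def] dbeta_def)
next
  case ExpRelax
  have "((\<lambda>z. exp (1 - z / \<delta>) - 1 - ln \<delta>) has_real_derivative exp (1 - z / \<delta>) * (- (1 / \<delta>))) (at z)"
    using assms by (auto intro!: derivative_eq_intros)
  thus ?thesis using ExpRelax by (simp add: beta_def[abs_def] dbeta_def)
qed

lemma dbeta_mono:
  assumes "valid_relax r" "0 < \<delta>" "x \<le> y"
  shows "dbeta r \<delta> x \<le> dbeta r \<delta> y"
proof (cases r)
  case (PolyRelax k)
  with assms have k: "2 \<le> k" "even k" by (auto simp: valid_relax_def)
  have "odd (k - 1)" using k by simp
  moreover have "(x - real k * \<delta>) / ((real k - 1) * \<delta>) \<le> (y - real k * \<delta>) / ((real k - 1) * \<delta>)"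
    using assms k by (intro divide_right_mono) auto
  ultimately have "((x - real k * \<delta>) / ((real k - 1) * \<delta>)) ^ (k - 1)
      \<le> ((y - real k * \<delta>) / ((real k - 1) * \<delta>)) ^ (k - 1)"
    by (rule power_mono_odd)
  thus ?thesis using PolyRelax assms by (simp add: dbeta_def divide_right_mono)
next
  case ExpRelax
  have "exp (1 - y / \<delta>) \<le> exp (1 - x / \<delta>)" using assms by (simp add: divide_right_mono)
  thus ?thesis using ExpRelax assms by (simp add: dbeta_def divide_right_mono)
qed

lemma dbeta_at_delta:
  assumes "valid_relax r" "0 < \<delta>"
  shows "dbeta r \<delta> \<delta> = - 1 / \<delta>"
proof (cases r)
  case (PolyRelax k)
  with assms have k: "2 \<le> k" "even k" by (auto simp: valid_relax_def)
  hence "(\<delta> - real k * \<delta>) / ((real k - 1) * \<delta>) = -1" "odd (k - 1)"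
    using assms by (simp_all add: field_simps)
  thus ?thesis using PolyRelax by (simp add: dbeta_def)
qed (use assms in \<open>simp add: dbeta_def\<close>)

lemma beta_at_delta:
  assumes "valid_relax r" "0 < \<delta>"
  shows "beta r \<delta> \<delta> = - ln \<delta>"
proof (cases r)
  case (PolyRelax k)
  with assms have k: "2 \<le> k" "even k" by (auto simp: valid_relax_def)
  hence "(\<delta> - real k * \<delta>) / ((real k - 1) * \<delta>) = -1" using assms by (simp add: field_simps)
  thus ?thesis using PolyRelax k by (simp add: beta_def)
qed (use assms in \<open>simp add: beta_def\<close>)

lemma beta_tangent_le:
  assumes "valid_relax r" "0 < \<delta>"
  shows "beta r \<delta> p + dbeta r \<delta> p * (z - p) \<le> beta r \<delta> z"
  by (rule tangent_le_of_mono_derivative[OF has_real_derivative_beta[OF assms] dbeta_mono[OF assms]])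

lemma minus_ln_tangent_le:
  fixes p z :: real
  assumes "0 < p" "0 < z"
  shows "- ln p - (z - p) / p \<le> - ln z"
proof -
  have "ln (z / p) \<le> z / p - 1" by (rule ln_le_minus_one) (use assms in simp)
  thus ?thesis using assms by (simp add: ln_div diff_divide_distrib)
qed

definition dBhat :: "relax_kind \<Rightarrow> real \<Rightarrow> real \<Rightarrow> real" where
  "dBhat r \<delta> z = (if z > \<delta> then - 1 / z else dbeta r \<delta> z)"

lemma Bhat_eq_minus_ln: "\<delta> < z \<Longrightarrow> Bhat r \<delta> z = - ln z"
  by (simp add: Bhat_def)

text \<open>The relaxation \<open>\<beta>\<close> agrees with \<open>- ln\<close> to first order at \<open>\<delta>\<close>, so both pieces of
  \<open>Bhat\<close> lie above the tangent of \<open>- ln\<close> at \<open>\<delta>\<close>; this glues the two convex pieces.\<close>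

lemma Bhat_tangent_le:
  assumes r: "valid_relax r" and d: "0 < \<delta>"
  shows "Bhat r \<delta> p + dBhat r \<delta> p * (z - p) \<le> Bhat r \<delta> z"
proof -
  note beta_tangent = beta_tangent_le[OF r d]
  have beta_ge: "- ln \<delta> - (z - \<delta>) / \<delta> \<le> beta r \<delta> z" for z
    using beta_tangent[of \<delta> z] dbeta_at_delta[OF r d] beta_at_delta[OF r d] by simp
  consider "\<delta> < p" "\<delta> < z" | "\<delta> < p" "z \<le> \<delta>" | "p \<le> \<delta>" "\<delta> < z" | "p \<le> \<delta>" "z \<le> \<delta>"
    by linarith
  then show ?thesis
  proof cases
    case 1
    thus ?thesis using d minus_ln_tangent_le[of p z] by (simp add: Bhat_def dBhat_def)
  next
    case 2
    have "- ln p - (\<delta> - p) / p \<le> - ln \<delta>" using minus_ln_tangent_le[of p \<delta>] d 2 by simp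
    moreover have "(\<delta> - z) * (1 / p) \<le> (\<delta> - z) * (1 / \<delta>)"
      using 2 d by (intro mult_left_mono) (auto simp: frac_le)
    moreover have "- ln p - (z - p) / p = - ln p - (\<delta> - p) / p + (\<delta> - z) * (1 / p)"
      "- ln \<delta> - (z - \<delta>) / \<delta> = - ln \<delta> + (\<delta> - z) * (1 / \<delta>)"
      using 2 d by (simp_all add: field_simps)
    ultimately have "- ln p - (z - p) / p \<le> beta r \<delta> z" using beta_ge[of z] by linarith
    thus ?thesis using 2 by (simp add: Bhat_def dBhat_def)
  next
    case 3
    have m: "dbeta r \<delta> p \<le> - 1 / \<delta>" using dbeta_mono[OF r d 3(1)] dbeta_at_delta[OF r d] by simp
    have "beta r \<delta> p + dbeta r \<delta> p * (z - p)
        = beta r \<delta> p + dbeta r \<delta> p * (\<delta> - p) + dbeta r \<delta> p * (z - \<delta>)"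
      by (simp add: algebra_simps)
    also have "\<dots> \<le> beta r \<delta> \<delta> + (- 1 / \<delta>) * (z - \<delta>)"
      using beta_tangent[of p \<delta>] mult_right_mono[OF m, of "z - \<delta>"] 3 by linarith
    also have "\<dots> \<le> - ln z" using minus_ln_tangent_le[of \<delta> z] beta_at_delta[OF r d] d 3 by simp
    finally show ?thesis using 3 by (simp add: Bhat_def dBhat_def)
  next
    case 4
    thus ?thesis using beta_tangent[of p z] by (simp add: Bhat_def dBhat_def)
  qed
qed

lemma dBhat_neg:
  assumes r: "valid_relax r" and d: "0 < \<delta>"
  shows "dBhat r \<delta> p < 0"
proof (cases "p > \<delta>")
  case False
  hence "dbeta r \<delta> p \<le> - 1 / \<delta>" using dbeta_mono[OF r d, of p \<delta>] dbeta_at_delta[OF r d] by simp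
  also have "\<dots> < 0" using d by simp
  finally show ?thesis using False by (simp add: dBhat_def)
qed (use d in \<open>simp add: dBhat_def\<close>)

lemma Bhat_antimono:
  assumes r: "valid_relax r" and d: "0 < \<delta>" and "a \<le> b"
  shows "Bhat r \<delta> b \<le> Bhat r \<delta> a"
proof -
  have "0 \<le> dBhat r \<delta> b * (a - b)"
    using dBhat_neg[OF r d, of b] assms(3) by (simp add: mult_nonpos_nonpos)
  thus ?thesis using Bhat_tangent_le[OF r d, of b a] by linarith
qed

lemma Bhat_convex:
  assumes r: "valid_relax r" and d: "0 < \<delta>" and t: "0 \<le> t" "t \<le> 1"
  shows "Bhat r \<delta> ((1 - t) * x + t * y) \<le> (1 - t) * Bhat r \<delta> x + t * Bhat r \<delta> y"
proof -
  let ?m = "(1 - t) * x + t * y"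
  let ?g = "dBhat r \<delta> ?m"
  have "(1 - t) * (Bhat r \<delta> ?m + ?g * (x - ?m)) + t * (Bhat r \<delta> ?m + ?g * (y - ?m))
      \<le> (1 - t) * Bhat r \<delta> x + t * Bhat r \<delta> y"
    using Bhat_tangent_le[OF r d] t by (intro add_mono mult_left_mono) auto
  moreover have "(1 - t) * (Bhat r \<delta> ?m + ?g * (x - ?m)) + t * (Bhat r \<delta> ?m + ?g * (y - ?m))
      = Bhat r \<delta> ?m"
    by (simp add: algebra_simps)
  ultimately show ?thesis by simp
qed

lemma Bhat_ge_tangent_at_delta:
  assumes r: "valid_relax r" and d: "0 < \<delta>" and z: "z \<le> \<delta>"
  shows "- ln \<delta> - (z - \<delta>) / \<delta> \<le> Bhat r \<delta> z"
  using beta_tangent_le[OF r d, of \<delta> z] dbeta_at_delta[OF r d] beta_at_delta[OF r d] z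
  by (simp add: Bhat_def)

section \<open>Quadratic forms\<close>

lemma matrix_vector_mult_norm_bound: "\<exists>c\<ge>0. \<forall>x. norm (A *v x) \<le> c * norm x"
  for A :: "real^'n::finite^'m::finite"
  using bounded_linear.nonneg_bounded[OF matrix_vector_mul_bounded_linear[of A]]
  by (metis mult.commute)

lemma qf_sym: "transpose Q = Q \<Longrightarrow> x \<bullet> (Q *v y) = y \<bullet> (Q *v x)" for Q :: "real^'n::finite^'n"
  by (metis dot_lmul_matrix inner_commute transpose_matrix_vector)

lemma qf_add: "transpose Q = Q \<Longrightarrow> qf Q (x + y) = qf Q x + qf Q y + 2 * (x \<bullet> (Q *v y))"
  for Q :: "real^'n::finite^'n"
  using qf_sym[of Q y x]
  by (simp add: qf_def matrix_vector_right_distrib inner_add_left inner_add_right)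

lemma qf_diff: "transpose Q = Q \<Longrightarrow> qf Q (x - y) = qf Q x + qf Q y - 2 * (x \<bullet> (Q *v y))"
  for Q :: "real^'n::finite^'n"
  using qf_sym[of Q y x]
  by (simp add: qf_def matrix_vector_mult_diff_distrib inner_diff_left inner_diff_right)

lemma qf_scaleR: "qf Q (c *\<^sub>R x) = c\<^sup>2 * qf Q x" for Q :: "real^'n::finite^'n"
  unfolding qf_def by (simp add: matrix_vector_mult_scaleR power2_eq_square)

lemma qf_midpoint: "transpose Q = Q \<Longrightarrow>
    qf Q ((1/2) *\<^sub>R (a + b)) = (qf Q a + qf Q b) / 2 - qf Q (a - b) / 4"
  for Q :: "real^'n::finite^'n"
  using qf_scaleR[of Q "1/2" "a + b"] qf_add[of Q a b] qf_diff[of Q a b]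
  by (simp add: power2_eq_square field_simps)

lemma psd_qf_nonneg: "psd Q \<Longrightarrow> 0 \<le> qf Q x"
  by (simp add: psd_def qf_def)

lemma pd_imp_psd: "pd P \<Longrightarrow> psd P"
  by (auto simp: pd_def psd_def) (metis inner_zero_left matrix_vector_mult_0_right order_refl less_imp_le)

lemma psd_qf_midpoint_le:
  fixes Q :: "real^'n::finite^'n"
  assumes "psd Q"
  shows "qf Q ((1/2) *\<^sub>R (a + b)) \<le> (qf Q a + qf Q b) / 2"
proof -
  have "transpose Q = Q" using assms by (simp add: psd_def)
  with qf_midpoint[of Q a b] psd_qf_nonneg[OF assms, of "a - b"] show ?thesis by linarith
qed

lemma qf_transpose_mult: "qf (transpose A ** P ** A) x = qf P (A *v x)"
  for A :: "real^'n::finite^'m::finite" and P :: "real^'m^'m"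
proof -
  have "(transpose A ** P ** A) *v x = transpose A *v (P *v (A *v x))"
    by (simp add: matrix_vector_mul_assoc matrix_mul_assoc)
  thus ?thesis unfolding qf_def by (metis dot_lmul_matrix inner_commute transpose_matrix_vector)
qed

lemma qf_matrix_add: "qf (X + Y) x = qf X x + qf Y x"
  by (simp add: qf_def matrix_vector_mult_add_rdistrib inner_add_right)

lemma qf_matrix_scaleR: "qf (c *\<^sub>R X) x = c * qf X x" for X :: "real^'n::finite^'n"
  by (simp add: qf_def scaleR_matrix_vector_assoc[symmetric])

lemma qf_abs_le_norm_sq: "\<exists>c\<ge>0. \<forall>x. \<bar>qf Q x\<bar> \<le> c * (norm x)\<^sup>2" for Q :: "real^'n::finite^'n"
proof -
  obtain c where c: "c \<ge> 0" "\<And>x. norm (Q *v x) \<le> c * norm x"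
    using matrix_vector_mult_norm_bound[of Q] by auto
  have "\<bar>qf Q x\<bar> \<le> c * (norm x)\<^sup>2" for x
  proof -
    have "\<bar>qf Q x\<bar> \<le> norm x * norm (Q *v x)" unfolding qf_def by (rule Cauchy_Schwarz_ineq2)
    also have "\<dots> \<le> norm x * (c * norm x)" by (intro mult_left_mono c) auto
    finally show ?thesis by (simp add: power2_eq_square algebra_simps)
  qed
  with c show ?thesis by blast
qed

lemma continuous_on_qf: "continuous_on S (qf Q)" for Q :: "real^'n::finite^'n"
  unfolding qf_def[abs_def]
  by (intro continuous_on_inner continuous_on_id linear_continuous_on[OF matrix_vector_mul_bounded_linear])

lemma pd_qf_ge_norm_sq:
  fixes P :: "real^'n::finite^'n"
  assumes "pd P"
  shows "\<exists>l>0. \<forall>x. l * (norm x)\<^sup>2 \<le> qf P x"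
proof -
  have "axis undefined 1 \<in> sphere (0::real^'n) 1" by (simp add: norm_axis_1)
  hence "sphere (0::real^'n) 1 \<noteq> {}" by blast
  then obtain x0 where x0: "x0 \<in> sphere 0 1" "\<And>y. y \<in> sphere 0 1 \<Longrightarrow> qf P x0 \<le> qf P y"
    using continuous_attains_inf[OF compact_sphere _ continuous_on_qf] by blast
  have "x0 \<noteq> 0" using x0(1) by auto
  hence l: "0 < qf P x0" using assms unfolding pd_def qf_def by blast
  have "qf P x0 * (norm x)\<^sup>2 \<le> qf P x" for x
  proof (cases "x = 0")
    case False
    hence "qf P x0 \<le> qf P ((1 / norm x) *\<^sub>R x)" by (intro x0(2)) simp
    also have "\<dots> = qf P x / (norm x)\<^sup>2" by (simp add: qf_scaleR power_divide)
    finally have "qf P x0 \<le> qf P x / (norm x)\<^sup>2" .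
    moreover have "0 < (norm x)\<^sup>2" using False by simp
    ultimately show ?thesis by (simp add: pos_le_divide_eq)
  qed (simp add: qf_def)
  with l show ?thesis by blast
qed

lemma pd_qf_nonneg: "pd X \<Longrightarrow> 0 \<le> qf X x"
  by (rule psd_qf_nonneg[OF pd_imp_psd])

section \<open>Recentered barriers\<close>

definition recenter_weight :: "'p recenter \<Rightarrow> 'p::finite \<Rightarrow> real" where
  "recenter_weight rc i = (case rc of GradRecenter \<Rightarrow> 1 | WeightRecenter w \<Rightarrow> 1 + w $ i)"

text \<open>The deviation of the scalar barrier \<open>b\<close> from its tangent at the nominal slack \<open>d\<close>
  (for \<open>b = - ln\<close>); both recenterings are weighted sums of these terms.\<close>

definition recentered_term :: "(real \<Rightarrow> real) \<Rightarrow> real \<Rightarrow> real \<Rightarrow> real" where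
  "recentered_term b d z = b z + ln d + z / d - 1"

lemma recenter_weight_ge_1: "valid_recenter C d rc \<Longrightarrow> 1 \<le> recenter_weight rc i"
  by (cases rc) (auto simp: recenter_weight_def valid_recenter_def)

lemma rbarrier_eq_weighted_sum:
  fixes C :: "real^'n::finite^'p::finite"
  assumes vr: "valid_recenter C d rc" and dpos: "\<forall>i. 0 < d $ i"
  shows "rbarrier b C d rc x
    = (\<Sum>i\<in>UNIV. recenter_weight rc i * recentered_term b (d $ i) (d $ i - C $ i \<bullet> x))"
proof (cases rc)
  case GradRecenter
  have "b (d $ i - C $ i \<bullet> x) + ln (d $ i) - (C $ i \<bullet> x) / d $ i
      = recentered_term b (d $ i) (d $ i - C $ i \<bullet> x)" for i
    using dpos[rule_format, of i] by (simp add: recentered_term_def field_simps)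
  thus ?thesis using GradRecenter by (simp add: rbarrier_def recenter_weight_def)
next
  case (WeightRecenter w)
  \<comment> \<open>The linear parts cancel by the recentering condition on the weights.\<close>
  have "(1 + w $ i) * ((d $ i - C $ i \<bullet> x) / d $ i - 1) = - ((((1 + w $ i) / d $ i) *\<^sub>R C $ i) \<bullet> x)"
    for i using dpos[rule_format, of i] by (simp add: field_simps)
  hence "(\<Sum>i\<in>UNIV. (1 + w $ i) * ((d $ i - C $ i \<bullet> x) / d $ i - 1))
      = - (\<Sum>i\<in>UNIV. ((1 + w $ i) / d $ i) *\<^sub>R C $ i) \<bullet> x"
    by (simp add: inner_sum_left sum_negf)
  hence lin: "(\<Sum>i\<in>UNIV. (1 + w $ i) * ((d $ i - C $ i \<bullet> x) / d $ i - 1)) = 0"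
    using vr WeightRecenter by (simp add: valid_recenter_def)
  have "rbarrier b C d rc x = (\<Sum>i\<in>UNIV. (1 + w $ i) * recentered_term b (d $ i) (d $ i - C $ i \<bullet> x)
      - (1 + w $ i) * ((d $ i - C $ i \<bullet> x) / d $ i - 1))"
    using WeightRecenter by (simp add: rbarrier_def recentered_term_def algebra_simps)
  also have "\<dots> = (\<Sum>i\<in>UNIV. (1 + w $ i) * recentered_term b (d $ i) (d $ i - C $ i \<bullet> x))"
    by (simp only: sum_subtractf lin diff_zero)
  finally show ?thesis using WeightRecenter by (simp add: recenter_weight_def)
qed

lemma recentered_term_Bhat_ge:
  assumes r: "valid_relax r" and d: "0 < \<delta>" "\<delta> \<le> dd" and z: "z \<le> \<delta>"
  shows "- ln \<delta> + ln dd - 1 + \<delta> / dd \<le> recentered_term (Bhat r \<delta>) dd z"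
proof -
  have "(\<delta> - z) * (1 / dd) \<le> (\<delta> - z) * (1 / \<delta>)"
    using z d by (intro mult_left_mono) (auto simp: frac_le)
  moreover have "(\<delta> - z) * (1 / dd) = \<delta> / dd - z / dd" by (simp add: diff_divide_distrib)
  moreover have "(\<delta> - z) * (1 / \<delta>) = - ((z - \<delta>) / \<delta>)" by (simp add: minus_divide_left)
  ultimately have "\<delta> / dd - z / dd \<le> - ((z - \<delta>) / \<delta>)" by simp
  thus ?thesis using Bhat_ge_tangent_at_delta[OF r d(1) z] unfolding recentered_term_def by linarith
qed

lemma recentered_term_Bhat_nonneg:
  assumes r: "valid_relax r" and d: "0 < \<delta>" "\<delta> \<le> dd"
  shows "0 \<le> recentered_term (Bhat r \<delta>) dd z"
proof (cases "z > \<delta>")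
  case True
  have "ln (z / dd) \<le> z / dd - 1" by (rule ln_le_minus_one) (use True d in simp)
  thus ?thesis using True d by (simp add: recentered_term_def Bhat_def ln_div)
next
  case False
  have "ln (\<delta> / dd) \<le> \<delta> / dd - 1" by (rule ln_le_minus_one) (use d in simp)
  thus ?thesis using recentered_term_Bhat_ge[OF r d, of z] False d by (simp add: ln_div)
qed

lemma rbarrier_Bhat_ge_term:
  fixes C :: "real^'n::finite^'p::finite"
  assumes vr: "valid_recenter C d rc" and dpos: "\<forall>i. 0 < d $ i" and r: "valid_relax r"
    and dl: "0 < \<delta>" "\<forall>i. \<delta> \<le> d $ i"
  shows "recentered_term (Bhat r \<delta>) (d $ i) (d $ i - C $ i \<bullet> x) \<le> rbarrier (Bhat r \<delta>) C d rc x"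
proof -
  let ?t = "\<lambda>j. recentered_term (Bhat r \<delta>) (d $ j) (d $ j - C $ j \<bullet> x)"
  have t: "0 \<le> ?t j" "1 \<le> recenter_weight rc j" for j
    using recentered_term_Bhat_nonneg[OF r dl(1)] dl(2) recenter_weight_ge_1[OF vr] by auto
  hence "?t i \<le> recenter_weight rc i * ?t i" using mult_right_mono[OF t(2) t(1), of i i] by simp
  also have "\<dots> \<le> (\<Sum>j\<in>UNIV. recenter_weight rc j * ?t j)"
    using t by (intro member_le_sum) (auto intro: mult_nonneg_nonneg order.trans[OF zero_le_one])
  finally show ?thesis using rbarrier_eq_weighted_sum[OF vr dpos] by simp
qed

lemma rbarrier_Bhat_nonneg:
  fixes C :: "real^'n::finite^'p::finite"
  assumes vr: "valid_recenter C d rc" and dpos: "\<forall>i. 0 < d $ i" and r: "valid_relax r"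
    and dl: "0 < \<delta>" "\<forall>i. \<delta> \<le> d $ i"
  shows "0 \<le> rbarrier (Bhat r \<delta>) C d rc x"
  unfolding rbarrier_eq_weighted_sum[OF vr dpos]
  using recentered_term_Bhat_nonneg[OF r dl(1)] dl(2) recenter_weight_ge_1[OF vr]
  by (auto intro!: sum_nonneg mult_nonneg_nonneg intro: order.trans[OF zero_le_one])

lemma rbarrier_Bhat_eq_log:
  assumes "\<forall>i. \<delta> < d $ i - C $ i \<bullet> x"
  shows "rbarrier (Bhat r \<delta>) C d rc x = rbarrier (\<lambda>z. - ln z) C d rc x"
  unfolding rbarrier_def using assms
  by (intro sum.cong refl) (auto simp: Bhat_eq_minus_ln split: recenter.splits)

lemma rbarrier_Bhat_convex:
  fixes C :: "real^'n::finite^'p::finite"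
  assumes vr: "valid_recenter C d rc" and dpos: "\<forall>i. 0 < d $ i" and r: "valid_relax r"
    and dl: "0 < \<delta>" and t: "0 \<le> t" "t \<le> 1"
  shows "rbarrier (Bhat r \<delta>) C d rc ((1 - t) *\<^sub>R x + t *\<^sub>R y)
     \<le> (1 - t) * rbarrier (Bhat r \<delta>) C d rc x + t * rbarrier (Bhat r \<delta>) C d rc y"
proof -
  let ?g = "recentered_term (Bhat r \<delta>)"
  have g: "?g dd ((1 - t) * a + t * b) \<le> (1 - t) * ?g dd a + t * ?g dd b" for dd a b
  proof -
    have "((1 - t) * a + t * b) / dd = (1 - t) * (a / dd) + t * (b / dd)"
      by (simp add: add_divide_distrib)
    with Bhat_convex[OF r dl t, of a b] show ?thesis
      unfolding recentered_term_def by (simp add: algebra_simps)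
  qed
  have slack: "d $ i - C $ i \<bullet> ((1 - t) *\<^sub>R x + t *\<^sub>R y)
      = (1 - t) * (d $ i - C $ i \<bullet> x) + t * (d $ i - C $ i \<bullet> y)" for i
    by (simp add: inner_add_right algebra_simps)
  have "recenter_weight rc i * ?g (d $ i) ((1 - t) * a + t * b)
      \<le> (1 - t) * (recenter_weight rc i * ?g (d $ i) a) + t * (recenter_weight rc i * ?g (d $ i) b)"
    for i a b
    using mult_left_mono[OF g, of "recenter_weight rc i"] recenter_weight_ge_1[OF vr, of i]
    by (simp add: distrib_left mult.left_commute)
  hence "(\<Sum>i\<in>UNIV. recenter_weight rc i * ?g (d $ i) (d $ i - C $ i \<bullet> ((1 - t) *\<^sub>R x + t *\<^sub>R y)))
      \<le> (\<Sum>i\<in>UNIV. (1 - t) * (recenter_weight rc i * ?g (d $ i) (d $ i - C $ i \<bullet> x))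
        + t * (recenter_weight rc i * ?g (d $ i) (d $ i - C $ i \<bullet> y)))"
    unfolding slack by (rule sum_mono)
  thus ?thesis
    by (simp add: rbarrier_eq_weighted_sum[OF vr dpos] sum.distrib sum_distrib_left)
qed

lemma rbarrier_log_le:
  fixes C :: "real^'n::finite^'p::finite"
  assumes vr: "valid_recenter C d rc" and dpos: "\<forall>i. 0 < d $ i" and m: "0 < m"
    and slack: "\<forall>i. m \<le> d $ i - C $ i \<bullet> x" and R: "norm x \<le> R"
  shows "rbarrier (\<lambda>z. - ln z) C d rc x
    \<le> (\<Sum>i\<in>UNIV. recenter_weight rc i * (\<bar>ln m\<bar> + \<bar>ln (d $ i)\<bar> + 1 + norm (C $ i) * R / d $ i))"
proof -
  have term_le: "recentered_term (\<lambda>z. - ln z) (d $ i) (d $ i - C $ i \<bullet> x)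
      \<le> \<bar>ln m\<bar> + \<bar>ln (d $ i)\<bar> + 1 + norm (C $ i) * R / d $ i" for i
  proof -
    have "ln m \<le> ln (d $ i - C $ i \<bullet> x)" using slack[rule_format, of i] m by simp
    moreover have "- (C $ i \<bullet> x) \<le> norm (C $ i) * R"
      using Cauchy_Schwarz_ineq2[of "C $ i" x] mult_left_mono[OF R, of "norm (C $ i)"] by auto
    hence "- (C $ i \<bullet> x) / d $ i \<le> norm (C $ i) * R / d $ i"
      using dpos[rule_format, of i] by (intro divide_right_mono) auto
    hence "(d $ i - C $ i \<bullet> x) / d $ i \<le> 1 + norm (C $ i) * R / d $ i"
      using dpos[rule_format, of i] by (simp add: diff_divide_distrib)
    ultimately show ?thesis unfolding recentered_term_def by linarith
  qed
  show ?thesis unfolding rbarrier_eq_weighted_sum[OF vr dpos]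
    using recenter_weight_ge_1[OF vr] term_le
    by (intro sum_mono mult_left_mono) (auto intro: order.trans[OF zero_le_one])
qed

lemma rbarrier_Bhat_ge_of_slack_le:
  fixes C :: "real^'n::finite^'p::finite"
  assumes vr: "valid_recenter C d rc" and dpos: "\<forall>i. 0 < d $ i" and r: "valid_relax r"
    and dl: "0 < \<delta>" "\<forall>i. \<delta> \<le> d $ i"
    and c: "c \<le> ln (d $ i) - 1" and slack: "d $ i - C $ i \<bullet> x \<le> \<delta>"
  shows "- ln \<delta> + c \<le> rbarrier (Bhat r \<delta>) C d rc x"
proof -
  have "0 \<le> \<delta> / d $ i" using dl dpos[rule_format, of i] by simp
  hence "- ln \<delta> + c \<le> - ln \<delta> + ln (d $ i) - 1 + \<delta> / d $ i" using c by linarith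
  also have "\<dots> \<le> recentered_term (Bhat r \<delta>) (d $ i) (d $ i - C $ i \<bullet> x)"
    using dl by (intro recentered_term_Bhat_ge[OF r _ _ slack]) auto
  also have "\<dots> \<le> rbarrier (Bhat r \<delta>) C d rc x"
    by (rule rbarrier_Bhat_ge_term[OF vr dpos r dl])
  finally show ?thesis .
qed

section \<open>Open-loop predictions\<close>

lemma pred_cong: "(\<And>j. j < k \<Longrightarrow> u j = v j) \<Longrightarrow> pred A B x u k = pred A B x v k"
  by (induction k) auto

lemma pred_linear:
  "pred A B (a *\<^sub>R x + b *\<^sub>R y) (\<lambda>j. a *\<^sub>R u j + b *\<^sub>R v j) k
     = a *\<^sub>R pred A B x u k + b *\<^sub>R pred A B y v k"
  for A :: "real^'n::finite^'n" and B :: "real^'m::finite^'n"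
  by (induction k) (simp_all add: matrix_vector_right_distrib matrix_vector_mult_scaleR algebra_simps)

lemma pred_diff: "pred A B x u k - pred A B x v k = pred A B 0 (\<lambda>j. u j - v j) k"
  for A :: "real^'n::finite^'n" and B :: "real^'m::finite^'n"
  by (induction k) (simp_all add: matrix_vector_mult_diff_distrib algebra_simps)

lemma pred_midpoint:
  "pred A B x (\<lambda>j. (1/2) *\<^sub>R (u j + v j)) k = (1/2) *\<^sub>R (pred A B x u k + pred A B x v k)"
  for A :: "real^'n::finite^'n" and B :: "real^'m::finite^'n"
  using pred_linear[of A B "1/2" x "1/2" x u v k] by (simp add: scaleR_right_distrib)

lemma pred_scaleR: "pred A B (s *\<^sub>R x) (\<lambda>j. s *\<^sub>R u j) k = s *\<^sub>R pred A B x u k"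
  for A :: "real^'n::finite^'n" and B :: "real^'m::finite^'n"
  by (induction k) (simp_all add: matrix_vector_mult_scaleR scaleR_right_distrib)

lemma pred_Suc_shift: "pred A B (A *v x + B *v u 0) (\<lambda>j. u (Suc j)) k = pred A B x u (Suc k)"
  by (induction k) simp_all

lemma pred_feedback:
  "pred A B x (\<lambda>j. K *v ((((*v) (A + B ** K)) ^^ j) x)) k = (((*v) (A + B ** K)) ^^ k) x"
  by (induction k) (simp_all add: matrix_vector_mult_add_rdistrib matrix_vector_mul_assoc)

lemma trajectory_eq_pred:
  assumes "\<And>k. xs (Suc k) = A *v xs k + B *v v k"
  shows "xs (k + j) = pred A B (xs k) (\<lambda>i. v (k + i)) j"
  by (induction j) (simp_all add: assms)

lemma pred_norm_le_power:
  fixes A :: "real^'n::finite^'n" and B :: "real^'m::finite^'n"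
  assumes a: "0 \<le> a" "\<And>x. norm (A *v x) \<le> a * norm x"
    and b: "0 \<le> b" "\<And>v. norm (B *v v) \<le> b * norm v"
  shows "norm (pred A B x u k) \<le> (1 + a + b) ^ k * (norm x + (\<Sum>j<k. norm (u j)))"
proof (induction k)
  case (Suc k)
  let ?q = "(1 + a + b) ^ k" and ?S = "norm x + (\<Sum>j<k. norm (u j))"
  have "1 \<le> ?q" "0 \<le> ?S" using a b by (simp_all add: sum_nonneg)
  have "norm (pred A B x u (Suc k)) \<le> a * norm (pred A B x u k) + b * norm (u k)"
    using a(2) b(2) norm_triangle_ineq[of "A *v pred A B x u k" "B *v u k"] by (simp add: add_mono order_trans)
  also have "\<dots> \<le> a * (?q * (?S + norm (u k))) + b * (?q * (?S + norm (u k)))"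
  proof (intro add_mono mult_left_mono)
    have "?q * ?S \<le> ?q * (?S + norm (u k))" using \<open>1 \<le> ?q\<close> by (intro mult_left_mono) auto
    with Suc.IH show "norm (pred A B x u k) \<le> ?q * (?S + norm (u k))" by linarith
    show "norm (u k) \<le> ?q * (?S + norm (u k))"
      using mult_right_mono[OF \<open>1 \<le> ?q\<close>, of "?S + norm (u k)"] \<open>0 \<le> ?S\<close> by simp
  qed (use a b in auto)
  also have "\<dots> \<le> (1 + a + b) * (?q * (?S + norm (u k)))"
    using \<open>1 \<le> ?q\<close> \<open>0 \<le> ?S\<close> by (simp add: distrib_right)
  finally show ?case by (simp add: add.assoc)
qed simp

lemma pred_norm_bound:
  fixes A :: "real^'n::finite^'n" and B :: "real^'m::finite^'n"
  shows "\<exists>c\<ge>0. \<forall>x u k. k \<le> N \<longrightarrow> norm (pred A B x u k) \<le> c * (norm x + (\<Sum>j<N. norm (u j)))"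
proof -
  obtain a where a: "0 \<le> a" "\<And>x. norm (A *v x) \<le> a * norm x"
    using matrix_vector_mult_norm_bound[of A] by auto
  obtain b where b: "0 \<le> b" "\<And>v. norm (B *v v) \<le> b * norm v"
    using matrix_vector_mult_norm_bound[of B] by auto
  have "norm (pred A B x u k) \<le> (1 + a + b) ^ N * (norm x + (\<Sum>j<N. norm (u j)))" if "k \<le> N" for x u k
  proof -
    have "(1 + a + b) ^ k * (norm x + (\<Sum>j<k. norm (u j)))
        \<le> (1 + a + b) ^ N * (norm x + (\<Sum>j<N. norm (u j)))"
      using that a b by (intro mult_mono power_increasing add_left_mono sum_mono2) (auto simp: sum_nonneg)
    thus ?thesis using pred_norm_le_power[OF a b, of x u k] by linarith
  qed
  thus ?thesis using a b by (intro exI[of _ "(1 + a + b) ^ N"]) auto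
qed

section \<open>Exponentially stable systems with vanishing perturbations\<close>

lemma funpow_matrix_vector_add: "(((*v) M) ^^ m) (a + b) = (((*v) M) ^^ m) a + (((*v) M) ^^ m) b"
  for M :: "real^'n::finite^'n"
  by (induction m) (simp_all add: matrix_vector_right_distrib)

lemma perturbed_trajectory_eq:
  fixes M :: "real^'n::finite^'n"
  assumes y: "\<And>k. y (Suc k) = M *v y k + e k"
  shows "y (k + m) = (((*v) M) ^^ m) (y k) + (\<Sum>i<m. (((*v) M) ^^ (m - Suc i)) (e (k + i)))"
proof (induction m arbitrary: k)
  case (Suc m)
  have "y (k + Suc m) = (((*v) M) ^^ m) (y (Suc k)) + (\<Sum>i<m. (((*v) M) ^^ (m - Suc i)) (e (Suc k + i)))"
    using Suc.IH[of "Suc k"] by simp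
  also have "(((*v) M) ^^ m) (y (Suc k)) = (((*v) M) ^^ Suc m) (y k) + (((*v) M) ^^ m) (e k)"
    by (simp only: y funpow_matrix_vector_add funpow_Suc_right o_def)
  also have "(\<Sum>i<Suc m. (((*v) M) ^^ (Suc m - Suc i)) (e (k + i)))
      = (((*v) M) ^^ m) (e k) + (\<Sum>i<m. (((*v) M) ^^ (m - Suc i)) (e (Suc k + i)))"
    by (subst sum.lessThan_Suc_shift) simp
  ultimately show ?case by (simp add: add.assoc)
qed simp

lemma perturbed_trajectory_norm_le:
  fixes M :: "real^'n::finite^'n"
  assumes decay: "\<And>k x. norm ((((*v) M) ^^ k) x) \<le> c * \<rho> ^ k * norm x"
    and c: "0 \<le> c" and \<rho>: "0 < \<rho>" "\<rho> < 1"
    and y: "\<And>k. y (Suc k) = M *v y k + e k"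
    and e: "\<And>i. k \<le> i \<Longrightarrow> norm (e i) \<le> E"
  shows "norm (y (k + m)) \<le> c * \<rho> ^ m * norm (y k) + c * E / (1 - \<rho>)"
proof -
  have "norm (\<Sum>i<m. (((*v) M) ^^ (m - Suc i)) (e (k + i))) \<le> (\<Sum>i<m. c * \<rho> ^ (m - Suc i) * E)"
    using decay e c \<rho>
    by (intro order_trans[OF norm_sum sum_mono] order_trans[OF decay mult_left_mono]) auto
  also have "\<dots> = c * E * (\<Sum>i<m. \<rho> ^ (m - Suc i))"
    by (simp add: sum_distrib_left algebra_simps)
  also have "\<dots> = c * E * (\<Sum>i<m. \<rho> ^ i)"
    by (simp only: sum.nat_diff_reindex)
  also have "\<dots> \<le> c * E * (1 / (1 - \<rho>))"
  proof (rule mult_left_mono)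
    show "(\<Sum>i<m. \<rho> ^ i) \<le> 1 / (1 - \<rho>)"
      using \<rho> sum_le_suminf[OF summable_geometric, of \<rho> "{..<m}"] suminf_geometric[of \<rho>] by auto
    show "0 \<le> c * E" using c e[of k] norm_ge_zero[of "e k"] by (simp del: norm_ge_zero)
  qed
  finally have "norm (\<Sum>i<m. (((*v) M) ^^ (m - Suc i)) (e (k + i))) \<le> c * E / (1 - \<rho>)" by simp
  moreover have "norm (y (k + m))
      \<le> norm ((((*v) M) ^^ m) (y k)) + norm (\<Sum>i<m. (((*v) M) ^^ (m - Suc i)) (e (k + i)))"
    unfolding perturbed_trajectory_eq[of y M e, OF y] by (rule norm_triangle_ineq)
  ultimately show ?thesis using decay[of m "y k"] by linarith
qed

lemma perturbed_trajectory_tendsto_0: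
  fixes M :: "real^'n::finite^'n"
  assumes decay: "\<And>k x. norm ((((*v) M) ^^ k) x) \<le> c * \<rho> ^ k * norm x"
    and c: "0 \<le> c" and \<rho>: "0 < \<rho>" "\<rho> < 1"
    and bounded: "\<And>k. norm (y k) \<le> Y"
    and y: "\<And>k. y (Suc k) = M *v y k + e k"
    and e: "e \<longlonglongrightarrow> 0"
  shows "y \<longlonglongrightarrow> 0"
proof (rule LIMSEQ_I)
  fix r :: real assume r: "0 < r"
  have "(\<lambda>m. c * \<rho> ^ m * Y) \<longlonglongrightarrow> c * 0 * Y"
    using \<rho> by (intro tendsto_intros LIMSEQ_power_zero) auto
  then obtain m where "\<bar>c * \<rho> ^ m * Y\<bar> < r / 2"
    using r by (auto dest!: LIMSEQ_D[of _ 0 "r/2"])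
  hence m: "c * \<rho> ^ m * Y < r / 2" by linarith
  define E where "E = r * (1 - \<rho>) / (2 * (c + 1))"
  have "0 < E" using r \<rho> c by (simp add: E_def)
  then obtain k where k: "\<And>i. k \<le> i \<Longrightarrow> norm (e i) \<le> E"
    using LIMSEQ_D[OF e] by (metis diff_zero less_imp_le)
  have "1 - \<rho> \<noteq> 0" "c + 1 \<noteq> 0" using \<rho> c by auto
  hence "c * E / (1 - \<rho>) = r / 2 * (c / (c + 1))" by (simp add: E_def)
  also have "\<dots> \<le> r / 2" using r c by (intro mult_left_le) auto
  finally have "c * E / (1 - \<rho>) \<le> r / 2" .
  have "\<forall>n\<ge>k + m. norm (y n) < r"
  proof (intro allI impI)
    fix n assume n: "k + m \<le> n"
    have "c * \<rho> ^ m * norm (y (n - m)) \<le> c * \<rho> ^ m * Y"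
      using bounded c \<rho> by (intro mult_left_mono) auto
    moreover have "norm (y ((n - m) + m)) \<le> c * \<rho> ^ m * norm (y (n - m)) + c * E / (1 - \<rho>)"
      using n k by (intro perturbed_trajectory_norm_le[where y=y and e=e, OF decay c \<rho> y]) auto
    ultimately have "norm (y ((n - m) + m)) < r"
      using \<open>c * E / (1 - \<rho>) \<le> r / 2\<close> m by linarith
    thus "norm (y n) < r" using n by simp
  qed
  thus "\<exists>no. \<forall>n\<ge>no. norm (y n - 0) < r" by auto
qed

section \<open>Elementary analysis\<close>

lemma le_sqrt_of_mult_sq_le: "0 < l \<Longrightarrow> l * t\<^sup>2 \<le> V \<Longrightarrow> t \<le> sqrt (V / l)" for l t V :: real
  by (rule real_le_rsqrt) (simp add: pos_le_divide_eq mult.commute)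

lemma eventually_at_right_0_less_on_compact:
  fixes f :: "'a::topological_space \<Rightarrow> real"
  assumes S: "compact S" and f: "continuous_on S f" "\<forall>x\<in>S. 0 < f x"
  shows "\<forall>\<^sub>F \<delta> in at_right 0. \<forall>x\<in>S. \<delta> < f x"
proof (cases "S = {}")
  case False
  then obtain x0 where x0: "x0 \<in> S" "\<And>y. y \<in> S \<Longrightarrow> f x0 \<le> f y"
    using continuous_attains_inf[OF S _ f(1)] by blast
  have "\<forall>\<^sub>F \<delta> in at_right 0. \<delta> < f x0"
    using f(2) x0(1) by (auto simp: eventually_at_right_field)
  thus ?thesis by (rule eventually_mono) (use x0(2) in force)
qed simp

lemma compact_subset_open_scaleR:
  fixes X0 S :: "'a::euclidean_space set"
  assumes X0: "compact X0" and S: "open S" "X0 \<subseteq> S"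
  shows "\<exists>t>0. \<forall>x\<in>X0. (1 + t) *\<^sub>R x \<in> S"
proof -
  obtain d where d: "0 < d" "\<And>x y. x \<in> X0 \<Longrightarrow> y \<in> - S \<Longrightarrow> d \<le> dist x y"
    using separate_compact_closed[OF X0, of "- S"] S by blast
  obtain R where R: "0 < R" "\<And>x. x \<in> X0 \<Longrightarrow> norm x \<le> R"
    using compact_imp_bounded[OF X0] unfolding bounded_pos by blast
  have "(1 + d / (2 * R)) *\<^sub>R x \<in> S" if x: "x \<in> X0" for x
  proof (rule ccontr)
    assume "(1 + d / (2 * R)) *\<^sub>R x \<notin> S"
    hence "d \<le> dist x ((1 + d / (2 * R)) *\<^sub>R x)" using d(2)[OF x] by simp
    also have "\<dots> = d / (2 * R) * norm x" using d(1) R(1) by (simp add: dist_norm algebra_simps)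
    also have "\<dots> \<le> d / (2 * R) * R" using R(2)[OF x] d(1) R(1) by (intro mult_left_mono) auto
    finally show False using d(1) R(1) by simp
  qed
  thus ?thesis using d(1) R(1) by (intro exI[of _ "d / (2 * R)"]) auto
qed

section \<open>The relaxed MPC problem\<close>

locale relaxed_mpc =
  fixes A :: "real^'n::finite^'n" and B :: "real^'m::finite^'n"
    and Cx :: "real^'n^'p::finite" and dx :: "real^'p"
    and Cu :: "real^'m^'q::finite" and du :: "real^'q"
    and Q :: "real^'n^'n" and R :: "real^'m^'m"
    and N :: nat and \<epsilon> :: real
    and r :: relax_kind and rcx :: "'p recenter" and rcu :: "'q recenter"
    and K :: "real^'n^'m" and M :: "real^'n^'n" and NN :: "(real^'n) set"
    and P :: "real^'n^'n" and \<phi> :: "real^'n \<Rightarrow> real"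
  assumes dx_pos: "\<forall>i. 0 < dx $ i" and du_pos: "\<forall>j. 0 < du $ j"
    and U_compact: "compact (polytope_set Cu du)"
    and Q_psd: "psd Q" and R_pd: "pd R"
    and N_pos: "1 \<le> N" and eps_pos: "0 < \<epsilon>"
    and r_valid: "valid_relax r"
    and rcx_valid: "valid_recenter Cx dx rcx" and rcu_valid: "valid_recenter Cu du rcu"
    and AK_schur: "schur (A + B ** K)"
    and NN_compact: "compact NN"
    and NN_bound: "\<forall>x\<in>NN. strictly_in Cx dx x \<and> strictly_in Cu du (K *v x) \<and>
                      log_barrier Cx dx rcx x + log_barrier Cu du rcu (K *v x) \<le> qf M x"
    and P_pd: "pd P"
    and P_lyap: "P = transpose (A + B ** K) ** P ** (A + B ** K) + transpose K ** R ** K + Q + \<epsilon> *\<^sub>R M"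
    and phi_cont: "continuous_on UNIV \<phi>"
    and phi_convex: "convex_on UNIV \<phi>"
    and phi_0: "\<phi> 0 = 0" and phi_pos: "\<forall>x. x \<noteq> 0 \<longrightarrow> 0 < \<phi> x"
    and phi_dec: "\<forall>x. \<phi> x \<le> 1 \<longrightarrow> \<phi> ((A + B ** K) *v x) \<le> \<phi> x"
    and Xf_sub: "{x. \<phi> x \<le> 1} \<subseteq> NN"
begin

abbreviation "AK \<equiv> A + B ** K"
abbreviation "bx \<delta> \<equiv> relaxed_barrier r \<delta> Cx dx rcx"
abbreviation "bu \<delta> \<equiv> relaxed_barrier r \<delta> Cu du rcu"
abbreviation "J \<delta> \<equiv> relaxed_cost A B Q R \<epsilon> N r \<delta> Cx dx rcx Cu du rcu P \<phi>"

definition stage_cost :: "real \<Rightarrow> real^'n \<Rightarrow> real^'m \<Rightarrow> real" where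
  "stage_cost \<delta> x v = qf Q x + qf R v + \<epsilon> * bu \<delta> v + \<epsilon> * bx \<delta> x"

definition terminal_cost :: "real \<Rightarrow> real^'n \<Rightarrow> real" where
  "terminal_cost \<delta> x = qf P x + \<epsilon> * Bhat r \<delta> (1 - \<phi> x)"

lemma relaxed_cost_eq_sum:
  "J \<delta> x u = (\<Sum>k<N. stage_cost \<delta> (pred A B x u k) (u k)) + terminal_cost \<delta> (pred A B x u N)"
  unfolding relaxed_cost_def stage_cost_def terminal_cost_def by simp

lemma phi_nonneg: "0 \<le> \<phi> x"
  using phi_0 phi_pos by (cases "x = 0") (auto intro: less_imp_le)

text \<open>Besides \<open>\<delta> \<le> 1/2\<close> and \<open>\<delta>\<close> below all constraint offsets, a small \<open>\<delta>\<close> leaves the barriers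
  unrelaxed on \<open>NN\<close>, where the terminal ingredients are formulated.\<close>

definition small_delta :: "real \<Rightarrow> bool" where
  "small_delta \<delta> \<longleftrightarrow> 0 < \<delta> \<and> \<delta> \<le> 1/2 \<and> (\<forall>i. \<delta> \<le> dx $ i) \<and> (\<forall>j. \<delta> \<le> du $ j)
     \<and> (\<forall>x\<in>NN. (\<forall>i. \<delta> < dx $ i - Cx $ i \<bullet> x) \<and> (\<forall>j. \<delta> < du $ j - Cu $ j \<bullet> (K *v x)))"

lemma state_barrier_nonneg: "small_delta \<delta> \<Longrightarrow> 0 \<le> bx \<delta> x"
  unfolding relaxed_barrier_def small_delta_def
  by (rule rbarrier_Bhat_nonneg[OF rcx_valid dx_pos r_valid]) auto

lemma input_barrier_nonneg: "small_delta \<delta> \<Longrightarrow> 0 \<le> bu \<delta> v"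
  unfolding relaxed_barrier_def small_delta_def
  by (rule rbarrier_Bhat_nonneg[OF rcu_valid du_pos r_valid]) auto

lemma terminal_barrier_nonneg:
  assumes "small_delta \<delta>"
  shows "0 \<le> Bhat r \<delta> (1 - \<phi> x)"
proof -
  have d: "0 < \<delta>" "\<delta> < 1" using assms by (auto simp: small_delta_def)
  have "Bhat r \<delta> 1 \<le> Bhat r \<delta> (1 - \<phi> x)"
    by (rule Bhat_antimono[OF r_valid d(1)]) (use phi_nonneg[of x] in simp)
  thus ?thesis using d by (simp add: Bhat_def)
qed

lemma stage_cost_nonneg: "small_delta \<delta> \<Longrightarrow> 0 \<le> stage_cost \<delta> x v"
  unfolding stage_cost_def
  using psd_qf_nonneg[OF Q_psd] pd_qf_nonneg[OF R_pd] state_barrier_nonneg input_barrier_nonneg eps_pos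
  by (simp add: add_nonneg_nonneg)

lemma terminal_cost_nonneg: "small_delta \<delta> \<Longrightarrow> 0 \<le> terminal_cost \<delta> x"
  unfolding terminal_cost_def using pd_qf_nonneg[OF P_pd] terminal_barrier_nonneg eps_pos
  by (simp add: add_nonneg_nonneg)

lemma stage_cost_le_relaxed_cost:
  assumes "small_delta \<delta>" "k < N"
  shows "stage_cost \<delta> (pred A B x u k) (u k) \<le> J \<delta> x u"
proof -
  have "stage_cost \<delta> (pred A B x u k) (u k) \<le> (\<Sum>k<N. stage_cost \<delta> (pred A B x u k) (u k))"
    using assms stage_cost_nonneg by (intro member_le_sum) auto
  thus ?thesis
    using terminal_cost_nonneg[OF assms(1), of "pred A B x u N"] relaxed_cost_eq_sum[of \<delta> x u]
    by linarith
qed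

lemma terminal_cost_le_relaxed_cost:
  assumes "small_delta \<delta>"
  shows "terminal_cost \<delta> (pred A B x u N) \<le> J \<delta> x u"
  using stage_cost_nonneg[OF assms] relaxed_cost_eq_sum[of \<delta> x u] by (simp add: sum_nonneg)

lemma relaxed_cost_nonneg: "small_delta \<delta> \<Longrightarrow> 0 \<le> J \<delta> x u"
  using terminal_cost_le_relaxed_cost terminal_cost_nonneg by (meson order_trans)

text \<open>The terminal ingredients: on the terminal set the relaxed barriers coincide with the
  nonrelaxed ones, so the Lyapunov equation for \<open>P\<close> and the bound by \<open>M\<close> make the terminal cost
  a control Lyapunov function for the feedback \<open>K\<close>.\<close>

lemma terminal_cost_decrease:
  assumes small: "small_delta \<delta>" and x: "\<phi> x \<le> 1"
  shows "terminal_cost \<delta> (AK *v x) + stage_cost \<delta> x (K *v x) \<le> terminal_cost \<delta> x"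
proof -
  have xN: "x \<in> NN" using x Xf_sub by auto
  have d: "0 < \<delta>" using small by (simp add: small_delta_def)
  have lyap: "qf P x = qf P (AK *v x) + qf R (K *v x) + qf Q x + \<epsilon> * qf M x"
    by (subst P_lyap) (simp add: qf_matrix_add qf_transpose_mult qf_matrix_scaleR)
  have "bx \<delta> x + bu \<delta> (K *v x) = log_barrier Cx dx rcx x + log_barrier Cu du rcu (K *v x)"
    using small xN unfolding relaxed_barrier_def log_barrier_def small_delta_def
    by (simp add: rbarrier_Bhat_eq_log)
  also have "\<dots> \<le> qf M x" using NN_bound xN by auto
  finally have "\<epsilon> * (bx \<delta> x + bu \<delta> (K *v x)) \<le> \<epsilon> * qf M x"
    using eps_pos by (intro mult_left_mono) auto
  moreover have "\<epsilon> * Bhat r \<delta> (1 - \<phi> (AK *v x)) \<le> \<epsilon> * Bhat r \<delta> (1 - \<phi> x)"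
    using phi_dec x eps_pos by (intro mult_left_mono Bhat_antimono[OF r_valid d]) auto
  ultimately show ?thesis
    using lyap unfolding terminal_cost_def stage_cost_def by (simp add: distrib_left)
qed

definition shifted_input :: "real^'n \<Rightarrow> (nat \<Rightarrow> real^'m) \<Rightarrow> nat \<Rightarrow> real^'m" where
  "shifted_input x u = (\<lambda>k. if Suc k < N then u (Suc k) else K *v pred A B x u N)"

lemma pred_shifted_input:
  assumes "k < N"
  shows "pred A B (A *v x + B *v u 0) (shifted_input x u) k = pred A B x u (Suc k)"
proof -
  have "pred A B (A *v x + B *v u 0) (shifted_input x u) k
      = pred A B (A *v x + B *v u 0) (\<lambda>j. u (Suc j)) k"
    by (rule pred_cong) (use assms in \<open>auto simp: shifted_input_def\<close>)
  thus ?thesis by (simp add: pred_Suc_shift)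
qed

lemma pred_shifted_input_N:
  "pred A B (A *v x + B *v u 0) (shifted_input x u) N = AK *v pred A B x u N"
proof -
  obtain N' where N': "Suc N' = N" using N_pos by (cases N) auto
  have "pred A B (A *v x + B *v u 0) (shifted_input x u) N
      = A *v pred A B (A *v x + B *v u 0) (shifted_input x u) N' + B *v shifted_input x u N'"
    by (simp flip: N')
  also have "\<dots> = A *v pred A B x u N + B *v (K *v pred A B x u N)"
    using pred_shifted_input[of N' x u] N' by (simp add: shifted_input_def)
  finally have "pred A B (A *v x + B *v u 0) (shifted_input x u) N
      = A *v pred A B x u N + B *v (K *v pred A B x u N)" .
  thus ?thesis by (simp add: matrix_vector_mult_add_rdistrib matrix_vector_mul_assoc)
qed

lemma relaxed_cost_shifted_input:
  "J \<delta> (A *v x + B *v u 0) (shifted_input x u)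
     = J \<delta> x u - stage_cost \<delta> x (u 0) - terminal_cost \<delta> (pred A B x u N)
       + stage_cost \<delta> (pred A B x u N) (K *v pred A B x u N) + terminal_cost \<delta> (AK *v pred A B x u N)"
proof -
  obtain N' where N': "Suc N' = N" using N_pos by (cases N) auto
  let ?x1 = "A *v x + B *v u 0" and ?w = "shifted_input x u" and ?y = "pred A B x u N"
  have "(\<Sum>k<N. stage_cost \<delta> (pred A B ?x1 ?w k) (?w k))
      = (\<Sum>k<N'. stage_cost \<delta> (pred A B ?x1 ?w k) (?w k)) + stage_cost \<delta> (pred A B ?x1 ?w N') (?w N')"
    by (simp flip: N')
  also have "(\<Sum>k<N'. stage_cost \<delta> (pred A B ?x1 ?w k) (?w k))
      = (\<Sum>k<N'. stage_cost \<delta> (pred A B x u (Suc k)) (u (Suc k)))"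
  proof (rule sum.cong)
    fix k assume "k \<in> {..<N'}"
    hence "k < N" "Suc k < N" using N' by auto
    thus "stage_cost \<delta> (pred A B ?x1 ?w k) (?w k) = stage_cost \<delta> (pred A B x u (Suc k)) (u (Suc k))"
      using pred_shifted_input[of k x u] by (simp add: shifted_input_def)
  qed simp
  also have "stage_cost \<delta> (pred A B ?x1 ?w N') (?w N') = stage_cost \<delta> ?y (K *v ?y)"
    using pred_shifted_input[of N' x u] N' by (simp add: shifted_input_def)
  moreover have "(\<Sum>k<N. stage_cost \<delta> (pred A B x u k) (u k))
      = stage_cost \<delta> x (u 0) + (\<Sum>k<N'. stage_cost \<delta> (pred A B x u (Suc k)) (u (Suc k)))"
    unfolding N'[symmetric] by (subst sum.lessThan_Suc_shift) simp
  ultimately show ?thesis unfolding relaxed_cost_eq_sum pred_shifted_input_N by simp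
qed

lemma relaxed_cost_shifted_input_le:
  assumes "small_delta \<delta>" "\<phi> (pred A B x u N) \<le> 1"
  shows "J \<delta> (A *v x + B *v u 0) (shifted_input x u) \<le> J \<delta> x u - stage_cost \<delta> x (u 0)"
  using relaxed_cost_shifted_input[of \<delta> x u] terminal_cost_decrease[OF assms] by simp

lemma phi_feedback_le: "\<phi> x \<le> 1 \<Longrightarrow> \<phi> ((((*v) AK) ^^ k) x) \<le> \<phi> x"
proof (induction k)
  case (Suc k)
  hence "\<phi> ((((*v) AK) ^^ k) x) \<le> 1" by linarith
  hence "\<phi> (AK *v (((*v) AK) ^^ k) x) \<le> \<phi> ((((*v) AK) ^^ k) x)" using phi_dec by blast
  thus ?case using Suc by simp
qed simp

lemma relaxed_cost_feedback_le:
  assumes small: "small_delta \<delta>" and x: "\<phi> x \<le> 1"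
  shows "J \<delta> x (\<lambda>j. K *v ((((*v) AK) ^^ j) x)) \<le> terminal_cost \<delta> x"
proof -
  have "(\<Sum>k<n. stage_cost \<delta> ((((*v) AK) ^^ k) x) (K *v ((((*v) AK) ^^ k) x)))
      + terminal_cost \<delta> ((((*v) AK) ^^ n) x) \<le> terminal_cost \<delta> x" for n
  proof (induction n)
    case (Suc n)
    have "\<phi> ((((*v) AK) ^^ n) x) \<le> 1" using phi_feedback_le[OF x, of n] x by linarith
    from terminal_cost_decrease[OF small this] Suc show ?case by simp
  qed simp
  thus ?thesis unfolding relaxed_cost_eq_sum pred_feedback by simp
qed

definition barrier_offset :: real where
  "barrier_offset = Min (insert 0 (range (\<lambda>i. ln (dx $ i) - 1) \<union> range (\<lambda>j. ln (du $ j) - 1)))"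

lemma barrier_offset_le: "barrier_offset \<le> 0" "barrier_offset \<le> ln (dx $ i) - 1"
    "barrier_offset \<le> ln (du $ j) - 1"
  unfolding barrier_offset_def by (rule Min_le; simp)+

text \<open>A cost below \<open>unrelaxed_level \<delta>\<close> keeps every constraint slack above \<open>\<delta>\<close>, so along
  such predictions the relaxed barriers are the logarithmic ones.\<close>

definition unrelaxed_level :: "real \<Rightarrow> real" where
  "unrelaxed_level \<delta> = \<epsilon> * (- ln \<delta> + barrier_offset)"

lemma slack_gt_delta_of_cost_below_level:
  assumes small: "small_delta \<delta>" and below: "J \<delta> x u < unrelaxed_level \<delta>"
  shows "k < N \<Longrightarrow> \<delta> < dx $ i - Cx $ i \<bullet> pred A B x u k"
    and "k < N \<Longrightarrow> \<delta> < du $ j - Cu $ j \<bullet> u k"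
    and "\<delta> < 1 - \<phi> (pred A B x u N)"
proof -
  have d: "0 < \<delta>" "\<forall>i. \<delta> \<le> dx $ i" "\<forall>j. \<delta> \<le> du $ j" using small by (auto simp: small_delta_def)
  have stage: "\<epsilon> * bx \<delta> (pred A B x u k) \<le> J \<delta> x u" "\<epsilon> * bu \<delta> (u k) \<le> J \<delta> x u" if "k < N" for k
  proof -
    have "0 \<le> \<epsilon> * bx \<delta> (pred A B x u k)" "0 \<le> \<epsilon> * bu \<delta> (u k)"
      using eps_pos state_barrier_nonneg[OF small] input_barrier_nonneg[OF small] by simp_all
    moreover have "0 \<le> qf Q (pred A B x u k)" "0 \<le> qf R (u k)"
      using psd_qf_nonneg[OF Q_psd] pd_qf_nonneg[OF R_pd] by auto
    ultimately show "\<epsilon> * bx \<delta> (pred A B x u k) \<le> J \<delta> x u" "\<epsilon> * bu \<delta> (u k) \<le> J \<delta> x u"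
      using stage_cost_le_relaxed_cost[OF small that, of x u] unfolding stage_cost_def by linarith+
  qed
  show "\<delta> < dx $ i - Cx $ i \<bullet> pred A B x u k" if "k < N"
  proof (rule ccontr)
    assume "\<not> ?thesis"
    hence "- ln \<delta> + barrier_offset \<le> bx \<delta> (pred A B x u k)"
      unfolding relaxed_barrier_def
      by (intro rbarrier_Bhat_ge_of_slack_le[OF rcx_valid dx_pos r_valid d(1,2) barrier_offset_le(2)[of i]])
        simp
    hence "unrelaxed_level \<delta> \<le> \<epsilon> * bx \<delta> (pred A B x u k)"
      unfolding unrelaxed_level_def using eps_pos by simp
    thus False using stage(1)[OF that] below by linarith
  qed
  show "\<delta> < du $ j - Cu $ j \<bullet> u k" if "k < N"
  proof (rule ccontr)
    assume "\<not> ?thesis"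
    hence "- ln \<delta> + barrier_offset \<le> bu \<delta> (u k)"
      unfolding relaxed_barrier_def
      by (intro rbarrier_Bhat_ge_of_slack_le[OF rcu_valid du_pos r_valid d(1,3) barrier_offset_le(3)[of j]])
        simp
    hence "unrelaxed_level \<delta> \<le> \<epsilon> * bu \<delta> (u k)"
      unfolding unrelaxed_level_def using eps_pos by simp
    thus False using stage(2)[OF that] below by linarith
  qed
  show "\<delta> < 1 - \<phi> (pred A B x u N)"
  proof (rule ccontr)
    let ?z = "1 - \<phi> (pred A B x u N)"
    assume "\<not> ?thesis"
    hence "- ln \<delta> + barrier_offset \<le> Bhat r \<delta> ?z"
      using Bhat_ge_tangent_at_delta[OF r_valid d(1), of ?z] barrier_offset_le(1) d(1)
      by (smt (verit) divide_nonpos_pos)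
    hence "unrelaxed_level \<delta> \<le> \<epsilon> * Bhat r \<delta> ?z"
      unfolding unrelaxed_level_def using eps_pos by simp
    moreover have "0 \<le> qf P (pred A B x u N)" by (rule pd_qf_nonneg[OF P_pd])
    ultimately show False
      using terminal_cost_le_relaxed_cost[OF small, of x u] below unfolding terminal_cost_def
      by linarith
  qed
qed

lemma closed_loopD:
  assumes "closed_loop A B (J \<delta>) xs us"
  shows "J \<delta> (xs k) (us k) \<le> J \<delta> (xs k) v" and "xs (Suc k) = A *v xs k + B *v us k 0"
  using assms unfolding closed_loop_def by blast+

lemma closed_loop_shifted_cost_le:
  assumes small: "small_delta \<delta>" and cl: "closed_loop A B (J \<delta>) xs us"
    and below: "J \<delta> (xs k) (us k) < unrelaxed_level \<delta>"
  shows "J \<delta> (xs (Suc k)) (shifted_input (xs k) (us k)) \<le> J \<delta> (xs k) (us k) - stage_cost \<delta> (xs k) (us k 0)"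
proof -
  have "\<phi> (pred A B (xs k) (us k) N) \<le> 1"
    using slack_gt_delta_of_cost_below_level(3)[OF small below] small by (simp add: small_delta_def)
  thus ?thesis unfolding closed_loopD(2)[OF cl] by (rule relaxed_cost_shifted_input_le[OF small])
qed

lemma closed_loop_cost_le_initial:
  assumes small: "small_delta \<delta>" and cl: "closed_loop A B (J \<delta>) xs us"
    and below: "J \<delta> (xs 0) (us 0) < unrelaxed_level \<delta>"
  shows "J \<delta> (xs k) (us k) \<le> J \<delta> (xs 0) (us 0)"
proof (induction k)
  case (Suc k)
  hence "J \<delta> (xs k) (us k) < unrelaxed_level \<delta>" using below by linarith
  from closed_loop_shifted_cost_le[OF small cl this] closed_loopD(1)[OF cl, of "Suc k"]
    stage_cost_nonneg[OF small, of "xs k" "us k 0"] Suc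
  show ?case by (smt (verit))
qed simp

lemma closed_loop_strictly_feasible:
  assumes small: "small_delta \<delta>" and cl: "closed_loop A B (J \<delta>) xs us"
    and below: "J \<delta> (xs 0) (us 0) < unrelaxed_level \<delta>"
  shows "strictly_in Cx dx (xs k) \<and> strictly_in Cu du (us k 0)"
proof -
  have below_k: "J \<delta> (xs k) (us k) < unrelaxed_level \<delta>"
    using closed_loop_cost_le_initial[OF small cl below, of k] below by linarith
  have "0 < N" "0 < \<delta>" using N_pos small by (auto simp: small_delta_def)
  with slack_gt_delta_of_cost_below_level(1,2)[OF small below_k, of 0]
  show ?thesis unfolding strictly_in_def by (smt (verit) pred.simps(1))
qed

lemma state_barrier_midpoint_le:
  "small_delta \<delta> \<Longrightarrow> bx \<delta> ((1/2) *\<^sub>R (a + b)) \<le> (bx \<delta> a + bx \<delta> b) / 2"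
  using rbarrier_Bhat_convex[OF rcx_valid dx_pos r_valid, of \<delta> "1/2" a b]
  by (simp add: relaxed_barrier_def small_delta_def scaleR_right_distrib)

lemma input_barrier_midpoint_le:
  "small_delta \<delta> \<Longrightarrow> bu \<delta> ((1/2) *\<^sub>R (a + b)) \<le> (bu \<delta> a + bu \<delta> b) / 2"
  using rbarrier_Bhat_convex[OF rcu_valid du_pos r_valid, of \<delta> "1/2" a b]
  by (simp add: relaxed_barrier_def small_delta_def scaleR_right_distrib)

lemma terminal_barrier_midpoint_le:
  assumes "small_delta \<delta>"
  shows "Bhat r \<delta> (1 - \<phi> ((1/2) *\<^sub>R (a + b))) \<le> (Bhat r \<delta> (1 - \<phi> a) + Bhat r \<delta> (1 - \<phi> b)) / 2"
proof -
  have d: "0 < \<delta>" using assms by (simp add: small_delta_def)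
  have "\<phi> ((1/2) *\<^sub>R (a + b)) \<le> (1 - 1/2) * \<phi> a + (1/2) * \<phi> b"
    using convex_onD[OF phi_convex, of "1/2" a b] by (simp add: scaleR_right_distrib)
  hence "Bhat r \<delta> (1 - \<phi> ((1/2) *\<^sub>R (a + b))) \<le> Bhat r \<delta> ((1 - 1/2) * (1 - \<phi> a) + (1/2) * (1 - \<phi> b))"
    by (intro Bhat_antimono[OF r_valid d]) argo
  also have "\<dots> \<le> (1 - 1/2) * Bhat r \<delta> (1 - \<phi> a) + (1/2) * Bhat r \<delta> (1 - \<phi> b)"
    by (rule Bhat_convex[OF r_valid d]) auto
  finally show ?thesis by simp
qed

lemma stage_cost_midpoint_le:
  assumes small: "small_delta \<delta>"
  shows "stage_cost \<delta> ((1/2) *\<^sub>R (p + q)) ((1/2) *\<^sub>R (a + b))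
     \<le> (stage_cost \<delta> p a + stage_cost \<delta> q b) / 2 - qf R (a - b) / 4"
proof -
  have "qf Q ((1/2) *\<^sub>R (p + q)) \<le> (qf Q p + qf Q q) / 2" by (rule psd_qf_midpoint_le[OF Q_psd])
  moreover have "qf R ((1/2) *\<^sub>R (a + b)) = (qf R a + qf R b) / 2 - qf R (a - b) / 4"
    using R_pd by (intro qf_midpoint) (simp add: pd_def)
  moreover have "\<epsilon> * bu \<delta> ((1/2) *\<^sub>R (a + b)) \<le> (\<epsilon> * bu \<delta> a + \<epsilon> * bu \<delta> b) / 2"
    using mult_left_mono[OF input_barrier_midpoint_le[OF small, of a b], of \<epsilon>] eps_pos
    by (simp add: field_simps)
  moreover have "\<epsilon> * bx \<delta> ((1/2) *\<^sub>R (p + q)) \<le> (\<epsilon> * bx \<delta> p + \<epsilon> * bx \<delta> q) / 2"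
    using mult_left_mono[OF state_barrier_midpoint_le[OF small, of p q], of \<epsilon>] eps_pos
    by (simp add: field_simps)
  ultimately show ?thesis unfolding stage_cost_def by argo
qed

lemma terminal_cost_midpoint_le:
  assumes small: "small_delta \<delta>"
  shows "terminal_cost \<delta> ((1/2) *\<^sub>R (p + q)) \<le> (terminal_cost \<delta> p + terminal_cost \<delta> q) / 2"
proof -
  have "qf P ((1/2) *\<^sub>R (p + q)) \<le> (qf P p + qf P q) / 2"
    by (rule psd_qf_midpoint_le[OF pd_imp_psd[OF P_pd]])
  moreover have "\<epsilon> * Bhat r \<delta> (1 - \<phi> ((1/2) *\<^sub>R (p + q)))
      \<le> (\<epsilon> * Bhat r \<delta> (1 - \<phi> p) + \<epsilon> * Bhat r \<delta> (1 - \<phi> q)) / 2"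
    using mult_left_mono[OF terminal_barrier_midpoint_le[OF small, of p q], of \<epsilon>] eps_pos
    by (simp add: field_simps)
  ultimately show ?thesis unfolding terminal_cost_def by argo
qed

text \<open>Strong convexity in the inputs: \<open>R\<close> is positive definite, all other terms are convex,
  and the predictions depend affinely on the inputs.\<close>

lemma relaxed_cost_midpoint_le:
  assumes small: "small_delta \<delta>"
  shows "J \<delta> x (\<lambda>k. (1/2) *\<^sub>R (u k + v k))
    \<le> (J \<delta> x u + J \<delta> x v) / 2 - (\<Sum>k<N. qf R (u k - v k)) / 4"
proof -
  let ?m = "\<lambda>k. (1/2) *\<^sub>R (u k + v k)"
  have "(\<Sum>k<N. stage_cost \<delta> (pred A B x ?m k) (?m k))
      \<le> (\<Sum>k<N. (stage_cost \<delta> (pred A B x u k) (u k) + stage_cost \<delta> (pred A B x v k) (v k)) / 2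
          - qf R (u k - v k) / 4)"
    by (rule sum_mono) (simp add: pred_midpoint stage_cost_midpoint_le[OF small])
  also have "\<dots> = ((\<Sum>k<N. stage_cost \<delta> (pred A B x u k) (u k))
      + (\<Sum>k<N. stage_cost \<delta> (pred A B x v k) (v k))) / 2 - (\<Sum>k<N. qf R (u k - v k)) / 4"
    by (simp only: sum_subtractf sum.distrib sum_divide_distrib[symmetric] add_divide_distrib)
  finally show ?thesis
    using terminal_cost_midpoint_le[OF small, of "pred A B x u N" "pred A B x v N"]
    unfolding relaxed_cost_eq_sum pred_midpoint by argo
qed

lemma optimal_cost_quadratic_growth:
  assumes "small_delta \<delta>" and opt: "\<And>w. J \<delta> x u \<le> J \<delta> x w"
  shows "J \<delta> x u + (\<Sum>k<N. qf R (u k - v k)) / 2 \<le> J \<delta> x v"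
  using relaxed_cost_midpoint_le[OF assms(1), of x u v] opt[of "\<lambda>k. (1/2) *\<^sub>R (u k + v k)"] by argo

section \<open>Bounds and convergence along the closed loop\<close>

lemma qf_le_relaxed_cost:
  assumes small: "small_delta \<delta>"
  shows "k < N \<Longrightarrow> qf R (u k) \<le> J \<delta> x u" and "qf P (pred A B x u N) \<le> J \<delta> x u"
proof -
  show "qf R (u k) \<le> J \<delta> x u" if "k < N"
  proof -
    have "0 \<le> qf Q (pred A B x u k)" "0 \<le> \<epsilon> * bu \<delta> (u k)" "0 \<le> \<epsilon> * bx \<delta> (pred A B x u k)"
      using psd_qf_nonneg[OF Q_psd] state_barrier_nonneg[OF small] input_barrier_nonneg[OF small] eps_pos
      by simp_all
    thus ?thesis using stage_cost_le_relaxed_cost[OF small that, of x u] unfolding stage_cost_def by linarith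
  qed
  have "0 \<le> \<epsilon> * Bhat r \<delta> (1 - \<phi> (pred A B x u N))"
    using terminal_barrier_nonneg[OF small] eps_pos by simp
  thus "qf P (pred A B x u N) \<le> J \<delta> x u"
    using terminal_cost_le_relaxed_cost[OF small, of x u] unfolding terminal_cost_def by linarith
qed

lemma qf_R_P_ge_norm_sq: "\<exists>l>0. \<forall>v x. l * (norm v)\<^sup>2 \<le> qf R v \<and> l * (norm x)\<^sup>2 \<le> qf P x"
proof -
  obtain lR lP where l: "0 < lR" "\<And>v. lR * (norm v)\<^sup>2 \<le> qf R v" "0 < lP" "\<And>x. lP * (norm x)\<^sup>2 \<le> qf P x"
    using pd_qf_ge_norm_sq[OF R_pd] pd_qf_ge_norm_sq[OF P_pd] by blast
  have "min lR lP * (norm v)\<^sup>2 \<le> qf R v \<and> min lR lP * (norm x)\<^sup>2 \<le> qf P x" for v x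
    using l(2)[of v] l(4)[of x] mult_right_mono[of "min lR lP" lR "(norm v)\<^sup>2"]
      mult_right_mono[of "min lR lP" lP "(norm x)\<^sup>2"] by auto
  with l show ?thesis by (intro exI[of _ "min lR lP"]) auto
qed

lemma closed_loop_norm_le:
  assumes small: "small_delta \<delta>" and cl: "closed_loop A B (J \<delta>) xs us"
    and below: "J \<delta> (xs 0) (us 0) < unrelaxed_level \<delta>"
    and l: "0 < l" "\<And>v x. l * (norm v)\<^sup>2 \<le> qf R v \<and> l * (norm x)\<^sup>2 \<le> qf P x"
  shows "j < N \<Longrightarrow> norm (us k j) \<le> sqrt (J \<delta> (xs 0) (us 0) / l)"
    and "norm (pred A B (xs k) (us k) N) \<le> sqrt (J \<delta> (xs 0) (us 0) / l)"
proof -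
  have J0: "J \<delta> (xs k) (us k) \<le> J \<delta> (xs 0) (us 0)" by (rule closed_loop_cost_le_initial[OF small cl below])
  show "norm (us k j) \<le> sqrt (J \<delta> (xs 0) (us 0) / l)" if "j < N"
    using l(2)[of "us k j" 0] qf_le_relaxed_cost(1)[OF small that, of "us k" "xs k"] J0
    by (intro le_sqrt_of_mult_sq_le[OF l(1)]) linarith
  show "norm (pred A B (xs k) (us k) N) \<le> sqrt (J \<delta> (xs 0) (us 0) / l)"
    using l(2)[of 0 "pred A B (xs k) (us k) N"] qf_le_relaxed_cost(2)[OF small, of "xs k" "us k"] J0
    by (intro le_sqrt_of_mult_sq_le[OF l(1)]) linarith
qed

lemma closed_loop_state_norm_le:
  assumes small: "small_delta \<delta>" and cl: "closed_loop A B (J \<delta>) xs us"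
    and below: "J \<delta> (xs 0) (us 0) < unrelaxed_level \<delta>"
    and l: "0 < l" "\<And>v x. l * (norm v)\<^sup>2 \<le> qf R v \<and> l * (norm x)\<^sup>2 \<le> qf P x"
    and c: "0 \<le> c" "\<forall>x u i. i \<le> N \<longrightarrow> norm (pred A B x u i) \<le> c * (norm x + (\<Sum>j<N. norm (u j)))"
  shows "k < N \<Longrightarrow> norm (xs k) \<le> c * (norm (xs 0) + real N * sqrt (J \<delta> (xs 0) (us 0) / l))"
    and "norm (xs (k + N))
      \<le> sqrt (J \<delta> (xs 0) (us 0) / l) + c * (real N * (2 * sqrt (J \<delta> (xs 0) (us 0) / l)))"
proof -
  define a where "a = sqrt (J \<delta> (xs 0) (us 0) / l)"
  note bounds = closed_loop_norm_le[OF small cl below l, folded a_def]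
  have traj: "xs (k + j) = pred A B (xs k) (\<lambda>i. us (k + i) 0) j" for k j
    by (rule trajectory_eq_pred[where v="\<lambda>k. us k 0", OF closed_loopD(2)[OF cl]])
  show "norm (xs k) \<le> c * (norm (xs 0) + real N * sqrt (J \<delta> (xs 0) (us 0) / l))" if "k < N"
  proof -
    have "norm (xs k) \<le> c * (norm (xs 0) + (\<Sum>j<N. norm (us j 0)))"
      using traj[of 0 k] c(2)[rule_format, where i=k] that by simp
    also have "\<dots> \<le> c * (norm (xs 0) + real N * a)"
      using sum_bounded_above[of "{..<N}" "\<lambda>j. norm (us j 0)" a] bounds(1)[of 0] N_pos c(1)
      by (intro mult_left_mono add_left_mono) auto
    finally show ?thesis unfolding a_def .
  qed
  \<comment> \<open>After \<open>N\<close> steps the state is the prediction made \<open>N\<close> steps earlier, up to the drift of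
    the applied inputs from the predicted ones.\<close>
  let ?drift = "pred A B 0 (\<lambda>j. us (k + j) 0 - us k j) N"
  have "xs (k + N) = pred A B (xs k) (us k) N + ?drift"
    using pred_diff[of A B "xs k" "\<lambda>i. us (k + i) 0" N "us k"] unfolding traj
    by (simp add: diff_eq_eq add.commute)
  moreover have "norm ?drift \<le> c * (real N * (2 * a))"
  proof -
    have "norm (us (k + j) 0 - us k j) \<le> 2 * a" if "j < N" for j
      using norm_triangle_ineq4[of "us (k + j) 0" "us k j"] bounds(1)[OF that, of k]
        bounds(1)[of 0 "k + j"] N_pos by simp
    hence "(\<Sum>j<N. norm (us (k + j) 0 - us k j)) \<le> real N * (2 * a)"
      using sum_bounded_above[of "{..<N}" "\<lambda>j. norm (us (k + j) 0 - us k j)" "2 * a"] by simp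
    moreover have "norm ?drift \<le> c * (norm (0::real^'n) + (\<Sum>j<N. norm (us (k + j) 0 - us k j)))"
      by (rule c(2)[rule_format]) simp
    ultimately show ?thesis using c(1) by (simp add: mult_left_mono order_trans)
  qed
  ultimately have "norm (xs (k + N)) \<le> a + c * (real N * (2 * a))"
    using norm_triangle_ineq[of "pred A B (xs k) (us k) N" ?drift] bounds(2)[of k] by simp
  thus "norm (xs (k + N))
      \<le> sqrt (J \<delta> (xs 0) (us 0) / l) + c * (real N * (2 * sqrt (J \<delta> (xs 0) (us 0) / l)))"
    unfolding a_def .
qed

lemma closed_loop_state_bound:
  "\<exists>c1 c2. 0 \<le> c1 \<and> 0 \<le> c2 \<and> (\<forall>\<delta> xs us k. small_delta \<delta> \<and> closed_loop A B (J \<delta>) xs us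
      \<and> J \<delta> (xs 0) (us 0) < unrelaxed_level \<delta>
      \<longrightarrow> norm (xs k) \<le> c1 * norm (xs 0) + c2 * sqrt (J \<delta> (xs 0) (us 0)))"
proof -
  obtain l where l: "0 < l" "\<And>v x. l * (norm v)\<^sup>2 \<le> qf R v \<and> l * (norm x)\<^sup>2 \<le> qf P x"
    using qf_R_P_ge_norm_sq by blast
  obtain c where c: "0 \<le> c" "\<forall>x u k. k \<le> N \<longrightarrow> norm (pred A B x u k) \<le> c * (norm x + (\<Sum>j<N. norm (u j)))"
    using pred_norm_bound[where A=A and B=B and N=N] by blast
  have "norm (xs k) \<le> c * norm (xs 0) + ((1 + 3 * c * real N) / sqrt l) * sqrt (J \<delta> (xs 0) (us 0))"
    if small: "small_delta \<delta>" and cl: "closed_loop A B (J \<delta>) xs us"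
      and below: "J \<delta> (xs 0) (us 0) < unrelaxed_level \<delta>" for \<delta> xs us k
  proof -
    define a where "a = sqrt (J \<delta> (xs 0) (us 0) / l)"
    have a: "0 \<le> a" "0 \<le> c * real N * a" "0 \<le> c * norm (xs 0)"
      using relaxed_cost_nonneg[OF small] l(1) c(1) by (simp_all add: a_def)
    note early_late = closed_loop_state_norm_le[OF small cl below l c, folded a_def]
    have "norm (xs k) \<le> c * norm (xs 0) + (1 + 3 * c * real N) * a"
    proof (cases "k < N")
      case True
      thus ?thesis using early_late(1)[OF True] a by (simp add: algebra_simps)
    next
      case False
      then obtain k' where "k = k' + N" by (metis add.commute le_iff_add not_less)
      thus ?thesis using early_late(2)[of k'] a by (simp add: algebra_simps)
    qed
    also have "(1 + 3 * c * real N) * a = ((1 + 3 * c * real N) / sqrt l) * sqrt (J \<delta> (xs 0) (us 0))"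
      using l(1) by (simp add: a_def real_sqrt_divide)
    finally show ?thesis .
  qed
  moreover have "0 \<le> (1 + 3 * c * real N) / sqrt l" using c(1) l(1) by simp
  ultimately show ?thesis using c(1) by blast
qed

definition input_mismatch :: "(nat \<Rightarrow> real^'n) \<Rightarrow> (nat \<Rightarrow> nat \<Rightarrow> real^'m) \<Rightarrow> nat \<Rightarrow> real" where
  "input_mismatch xs us k = (\<Sum>j<N. norm (us (Suc k) j - shifted_input (xs k) (us k) j))"

text \<open>The optimal costs decrease at least by the stage cost; by quadratic growth of the cost
  around its minimizer, the optimal input sequences therefore eventually agree with the shifted
  ones.\<close>

lemma closed_loop_input_mismatch_tendsto_0:
  assumes small: "small_delta \<delta>" and cl: "closed_loop A B (J \<delta>) xs us"
    and below: "J \<delta> (xs 0) (us 0) < unrelaxed_level \<delta>"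
  shows "input_mismatch xs us \<longlonglongrightarrow> 0"
proof -
  define V where "V k = J \<delta> (xs k) (us k)" for k
  obtain l where l: "0 < l" "\<And>v. l * (norm v)\<^sup>2 \<le> qf R v"
    using qf_R_P_ge_norm_sq by blast
  have below_k: "V k < unrelaxed_level \<delta>" for k
    using closed_loop_cost_le_initial[OF small cl below, of k] below by (simp add: V_def)
  have shifted: "J \<delta> (xs (Suc k)) (shifted_input (xs k) (us k)) \<le> V k" for k
    using closed_loop_shifted_cost_le[OF small cl below_k[of k, unfolded V_def]]
      stage_cost_nonneg[OF small, of "xs k" "us k 0"] unfolding V_def by linarith
  have "V (Suc k) \<le> V k" for k
    using closed_loopD(1)[OF cl, of "Suc k" "shifted_input (xs k) (us k)"] shifted[of k]
    by (simp add: V_def)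
  hence "decseq V" by (simp add: decseq_Suc_iff)
  moreover have "\<forall>k. 0 \<le> V k" using relaxed_cost_nonneg[OF small] by (simp add: V_def)
  ultimately obtain L where L: "V \<longlonglongrightarrow> L" by (rule decseq_convergent)
  have Vdiff: "(\<lambda>k. real N * sqrt (2 * (V k - V (Suc k)) / l)) \<longlonglongrightarrow> real N * sqrt (2 * (L - L) / l)"
    using l(1) by (intro tendsto_intros L LIMSEQ_Suc[OF L]) simp
  have bound: "input_mismatch xs us k \<le> real N * sqrt (2 * (V k - V (Suc k)) / l)" for k
  proof -
    let ?w = "shifted_input (xs k) (us k)"
    have growth: "V (Suc k) + (\<Sum>j<N. qf R (us (Suc k) j - ?w j)) / 2 \<le> V k"
      using optimal_cost_quadratic_growth[OF small closed_loopD(1)[OF cl], of "Suc k" ?w]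
        shifted[of k] by (simp add: V_def)
    have "norm (us (Suc k) j - ?w j) \<le> sqrt (2 * (V k - V (Suc k)) / l)" if "j < N" for j
    proof (rule le_sqrt_of_mult_sq_le[OF l(1)])
      have "qf R (us (Suc k) j - ?w j) \<le> (\<Sum>j<N. qf R (us (Suc k) j - ?w j))"
        using that by (intro member_le_sum pd_qf_nonneg[OF R_pd]) auto
      thus "l * (norm (us (Suc k) j - ?w j))\<^sup>2 \<le> 2 * (V k - V (Suc k))"
        using l(2)[of "us (Suc k) j - ?w j"] growth by argo
    qed
    thus ?thesis
      using sum_bounded_above[of "{..<N}" "\<lambda>j. norm (us (Suc k) j - ?w j)" "sqrt (2 * (V k - V (Suc k)) / l)"]
      unfolding input_mismatch_def by simp
  qed
  have "\<forall>\<^sub>F k in sequentially. norm (input_mismatch xs us k) \<le> real N * sqrt (2 * (V k - V (Suc k)) / l)"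
    using bound by (simp add: input_mismatch_def sum_nonneg)
  moreover have "(\<lambda>k. real N * sqrt (2 * (V k - V (Suc k)) / l)) \<longlonglongrightarrow> 0" using Vdiff by simp
  ultimately show ?thesis by (rule Lim_null_comparison)
qed

text \<open>The predicted terminal states evolve under the stable feedback \<open>A + B K\<close>, perturbed by
  the input mismatch.\<close>

lemma closed_loop_terminal_prediction_tendsto_0:
  assumes small: "small_delta \<delta>" and cl: "closed_loop A B (J \<delta>) xs us"
    and below: "J \<delta> (xs 0) (us 0) < unrelaxed_level \<delta>"
  shows "(\<lambda>k. pred A B (xs k) (us k) N) \<longlonglongrightarrow> 0"
proof -
  define y where "y k = pred A B (xs k) (us k) N" for k
  define e where "e k = pred A B 0 (\<lambda>j. us (Suc k) j - shifted_input (xs k) (us k) j) N" for k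
  obtain c0 \<rho> where decay: "0 \<le> c0" "0 < \<rho>" "\<rho> < 1" "\<And>k x. norm ((((*v) AK) ^^ k) x) \<le> c0 * \<rho> ^ k * norm x"
    using schur_imp_exp_decay[OF AK_schur] by blast
  obtain l where l: "0 < l" "\<And>v x. l * (norm v)\<^sup>2 \<le> qf R v \<and> l * (norm x)\<^sup>2 \<le> qf P x"
    using qf_R_P_ge_norm_sq by blast
  obtain c where c: "0 \<le> c" "\<And>x u k. k \<le> N \<Longrightarrow> norm (pred A B x u k) \<le> c * (norm x + (\<Sum>j<N. norm (u j)))"
    using pred_norm_bound[where A=A and B=B and N=N] by blast
  have rec: "y (Suc k) = AK *v y k + e k" for k
  proof -
    have "AK *v y k = pred A B (xs (Suc k)) (shifted_input (xs k) (us k)) N"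
      unfolding closed_loopD(2)[OF cl] y_def by (rule pred_shifted_input_N[symmetric])
    thus ?thesis
      using pred_diff[of A B "xs (Suc k)" "us (Suc k)" N "shifted_input (xs k) (us k)"]
      unfolding y_def e_def by (metis add.commute diff_add_cancel)
  qed
  have e0: "e \<longlonglongrightarrow> 0"
  proof (rule Lim_null_comparison)
    show "\<forall>\<^sub>F k in sequentially. norm (e k) \<le> c * input_mismatch xs us k"
      using c(2)[of N 0] by (simp add: e_def input_mismatch_def)
    show "(\<lambda>k. c * input_mismatch xs us k) \<longlonglongrightarrow> 0"
      using tendsto_mult_right_zero[OF closed_loop_input_mismatch_tendsto_0[OF small cl below]] .
  qed
  have bounded: "norm (y k) \<le> sqrt (J \<delta> (xs 0) (us 0) / l)" for k
    unfolding y_def by (rule closed_loop_norm_le(2)[OF small cl below l])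
  from perturbed_trajectory_tendsto_0[OF decay(4,1,2,3) bounded rec e0] show ?thesis
    by (simp add: y_def)
qed

lemma closed_loop_input_drift_le:
  assumes "j < N"
  shows "norm (us (k + j) 0 - us k j) \<le> (\<Sum>i<j. input_mismatch xs us (k + i))"
  using assms
proof (induction j arbitrary: k)
  case (Suc j)
  have "shifted_input (xs k) (us k) j = us k (Suc j)" using Suc.prems by (simp add: shifted_input_def)
  hence "norm (us (k + Suc j) 0 - us k (Suc j))
      \<le> norm (us (Suc k + j) 0 - us (Suc k) j) + norm (us (Suc k) j - shifted_input (xs k) (us k) j)"
    using norm_triangle_ineq[of "us (Suc k + j) 0 - us (Suc k) j" "us (Suc k) j - us k (Suc j)"] by simp
  also have "\<dots> \<le> (\<Sum>i<j. input_mismatch xs us (Suc k + i)) + input_mismatch xs us k"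
  proof (rule add_mono)
    show "norm (us (Suc k + j) 0 - us (Suc k) j) \<le> (\<Sum>i<j. input_mismatch xs us (Suc k + i))"
      using Suc.IH[of "Suc k"] Suc.prems by simp
    show "norm (us (Suc k) j - shifted_input (xs k) (us k) j) \<le> input_mismatch xs us k"
      unfolding input_mismatch_def using Suc.prems by (intro member_le_sum) auto
  qed
  also have "\<dots> = (\<Sum>i<Suc j. input_mismatch xs us (k + i))"
    by (subst sum.lessThan_Suc_shift) simp
  finally show ?case .
qed simp

theorem closed_loop_tendsto_0:
  assumes small: "small_delta \<delta>" and cl: "closed_loop A B (J \<delta>) xs us"
    and below: "J \<delta> (xs 0) (us 0) < unrelaxed_level \<delta>"
  shows "xs \<longlonglongrightarrow> 0"
proof -
  obtain c where c: "0 \<le> c" "\<And>x u k. k \<le> N \<Longrightarrow> norm (pred A B x u k) \<le> c * (norm x + (\<Sum>j<N. norm (u j)))"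
    using pred_norm_bound[where A=A and B=B and N=N] by blast
  define z where "z k = pred A B 0 (\<lambda>j. us (k + j) 0 - us k j) N" for k
  define g where "g k = c * (\<Sum>j<N. \<Sum>i<j. input_mismatch xs us (k + i))" for k
  have split: "xs (k + N) = pred A B (xs k) (us k) N + z k" for k
  proof -
    have "pred A B (xs k) (\<lambda>i. us (k + i) 0) N = pred A B (xs k) (us k) N + z k"
      using pred_diff[of A B "xs k" "\<lambda>i. us (k + i) 0" N "us k"] unfolding z_def
      by (simp add: diff_eq_eq add.commute)
    thus ?thesis by (simp add: trajectory_eq_pred[where v="\<lambda>k. us k 0", OF closed_loopD(2)[OF cl]])
  qed
  have z_le: "norm (z k) \<le> g k" for k
  proof -
    have "norm (z k) \<le> c * (norm (0::real^'n) + (\<Sum>j<N. norm (us (k + j) 0 - us k j)))"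
      unfolding z_def by (rule c(2)) simp
    moreover have "(\<Sum>j<N. norm (us (k + j) 0 - us k j)) \<le> (\<Sum>j<N. \<Sum>i<j. input_mismatch xs us (k + i))"
      by (rule sum_mono) (simp add: closed_loop_input_drift_le)
    ultimately show ?thesis unfolding g_def using c(1) by (simp add: mult_left_mono order_trans)
  qed
  have "g \<longlonglongrightarrow> c * (\<Sum>j<N. \<Sum>i<j. 0)"
    unfolding g_def
    by (intro tendsto_intros LIMSEQ_ignore_initial_segment[OF
          closed_loop_input_mismatch_tendsto_0[OF small cl below]])
  hence "g \<longlonglongrightarrow> 0" by (simp only: sum.neutral_const mult_zero_right)
  with always_eventually[OF allI[OF z_le]] have "z \<longlonglongrightarrow> 0" by (rule Lim_null_comparison)
  hence "(\<lambda>k. pred A B (xs k) (us k) N + z k) \<longlonglongrightarrow> 0 + 0"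
    by (intro tendsto_add closed_loop_terminal_prediction_tendsto_0[OF small cl below])
  hence "(\<lambda>k. xs (k + N)) \<longlonglongrightarrow> 0" unfolding split[symmetric] by simp
  thus ?thesis by (rule LIMSEQ_offset)
qed

section \<open>Choice of the relaxation parameter\<close>

lemma eventually_small_delta: "\<forall>\<^sub>F \<delta> in at_right 0. small_delta \<delta>"
proof -
  have le: "\<forall>\<^sub>F \<delta> in at_right 0. \<delta> \<le> c" if "0 < c" for c :: real
    using that by (auto simp: eventually_at_right_field)
  have "continuous_on NN (\<lambda>x. Cu $ j \<bullet> (K *v x))" for j
    by (intro continuous_on_inner continuous_on_const linear_continuous_on matrix_vector_mul_bounded_linear)
  hence "\<forall>\<^sub>F \<delta> in at_right 0. (\<forall>i. \<forall>x\<in>NN. \<delta> < dx $ i - Cx $ i \<bullet> x) \<and> (\<forall>j. \<forall>x\<in>NN. \<delta> < du $ j - Cu $ j \<bullet> (K *v x))"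
    using NN_bound
    by (intro eventually_conj eventually_all_finite eventually_at_right_0_less_on_compact[OF NN_compact])
      (auto intro!: continuous_intros simp: strictly_in_def)
  moreover have "\<forall>\<^sub>F \<delta> in at_right 0. 0 < \<delta> \<and> \<delta> \<le> 1/2 \<and> (\<forall>i. \<delta> \<le> dx $ i) \<and> (\<forall>j. \<delta> \<le> du $ j)"
    using dx_pos du_pos by (intro eventually_conj eventually_at_right_less le eventually_all_finite) auto
  ultimately show ?thesis
    by (rule eventually_mono[OF eventually_conj]) (auto simp: small_delta_def)
qed

lemma eventually_unrelaxed_level_gt: "\<forall>\<^sub>F \<delta> in at_right 0. C < unrelaxed_level \<delta>"
proof -
  have "\<forall>\<^sub>F \<delta> in at_right 0. ln \<delta> \<le> barrier_offset - C / \<epsilon> - 1"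
    using ln_at_0 by (simp add: filterlim_at_bot)
  thus ?thesis
  proof (rule eventually_mono)
    fix \<delta> :: real assume "ln \<delta> \<le> barrier_offset - C / \<epsilon> - 1"
    hence "C / \<epsilon> < - ln \<delta> + barrier_offset" by linarith
    thus "C < unrelaxed_level \<delta>" using eps_pos by (simp add: unrelaxed_level_def pos_divide_less_eq mult.commute)
  qed
qed

lemma scaled_feasible_input:
  assumes y: "y \<in> feasible_set A B (polytope_set Cx dx) (polytope_set Cu du) {x. \<phi> x \<le> 1} N"
    and s: "0 \<le> s" "s \<le> 1"
  obtains u where "\<And>k. k < N \<Longrightarrow> \<exists>v\<in>polytope_set Cu du. u k = s *\<^sub>R v"
    and "\<And>k i. k < N \<Longrightarrow> (1 - s) * dx $ i \<le> dx $ i - Cx $ i \<bullet> pred A B (s *\<^sub>R y) u k"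
    and "\<And>k j. k < N \<Longrightarrow> (1 - s) * du $ j \<le> du $ j - Cu $ j \<bullet> u k"
    and "1 - s \<le> 1 - \<phi> (pred A B (s *\<^sub>R y) u N)"
proof -
  obtain u where u: "\<And>k. k < N \<Longrightarrow> u k \<in> polytope_set Cu du"
      "\<And>k. k < N \<Longrightarrow> pred A B y u k \<in> polytope_set Cx dx" "\<phi> (pred A B y u N) \<le> 1"
    using y unfolding feasible_set_def by blast
  have scaled: "pred A B (s *\<^sub>R y) (\<lambda>k. s *\<^sub>R u k) k = s *\<^sub>R pred A B y u k" for k
    by (rule pred_scaleR)
  have slack: "(1 - s) * d \<le> d - s * a" if "a \<le> d" for a d :: real
    using mult_left_mono[OF that s(1)] by (simp add: algebra_simps)
  have "\<phi> (s *\<^sub>R pred A B y u N) \<le> (1 - s) * \<phi> 0 + s * \<phi> (pred A B y u N)"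
    using convex_onD[OF phi_convex, of s 0 "pred A B y u N"] s by simp
  also have "\<dots> \<le> s" using phi_0 u(3) s(1) by (simp add: mult_left_le)
  finally show ?thesis
    using u(1,2) by (intro that[of "\<lambda>k. s *\<^sub>R u k"]) (auto simp: scaled polytope_set_def intro!: slack)
qed

lemma stage_cost_bounded_of_slack:
  assumes m: "0 < m"
  shows "\<exists>S. \<forall>\<delta> x v. \<delta> < m \<longrightarrow> norm x \<le> Rx \<longrightarrow> norm v \<le> Ru
      \<longrightarrow> (\<forall>i. m \<le> dx $ i - Cx $ i \<bullet> x) \<longrightarrow> (\<forall>j. m \<le> du $ j - Cu $ j \<bullet> v)
      \<longrightarrow> stage_cost \<delta> x v \<le> S"
proof -
  obtain cQ cR where cQ: "\<And>x. \<bar>qf Q x\<bar> \<le> cQ * (norm x)\<^sup>2" "0 \<le> cQ"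
      and cR: "\<And>v. \<bar>qf R v\<bar> \<le> cR * (norm v)\<^sup>2" "0 \<le> cR"
    using qf_abs_le_norm_sq[of Q] qf_abs_le_norm_sq[of R] by metis
  define BX where "BX = (\<Sum>i\<in>UNIV. recenter_weight rcx i * (\<bar>ln m\<bar> + \<bar>ln (dx $ i)\<bar> + 1 + norm (Cx $ i) * Rx / dx $ i))"
  define BU where "BU = (\<Sum>j\<in>UNIV. recenter_weight rcu j * (\<bar>ln m\<bar> + \<bar>ln (du $ j)\<bar> + 1 + norm (Cu $ j) * Ru / du $ j))"
  have "stage_cost \<delta> x v \<le> cQ * Rx\<^sup>2 + cR * Ru\<^sup>2 + \<epsilon> * BU + \<epsilon> * BX"
    if d: "\<delta> < m" and x: "norm x \<le> Rx" and v: "norm v \<le> Ru"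
      and sx: "\<forall>i. m \<le> dx $ i - Cx $ i \<bullet> x" and sv: "\<forall>j. m \<le> du $ j - Cu $ j \<bullet> v" for \<delta> x v
  proof -
    have "bx \<delta> x = log_barrier Cx dx rcx x"
      unfolding relaxed_barrier_def log_barrier_def
      by (intro rbarrier_Bhat_eq_log allI less_le_trans[OF d]) (use sx in blast)
    also have "\<dots> \<le> BX" unfolding log_barrier_def BX_def by (rule rbarrier_log_le[OF rcx_valid dx_pos m sx x])
    finally have "\<epsilon> * bx \<delta> x \<le> \<epsilon> * BX" using eps_pos by simp
    moreover have "bu \<delta> v = log_barrier Cu du rcu v"
      unfolding relaxed_barrier_def log_barrier_def
      by (intro rbarrier_Bhat_eq_log allI less_le_trans[OF d]) (use sv in blast)
    moreover have "\<dots> \<le> BU" unfolding log_barrier_def BU_def by (rule rbarrier_log_le[OF rcu_valid du_pos m sv v])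
    moreover have "cQ * (norm x)\<^sup>2 \<le> cQ * Rx\<^sup>2" "cR * (norm v)\<^sup>2 \<le> cR * Ru\<^sup>2"
      using x v cQ(2) cR(2) by (intro mult_left_mono power_mono; simp)+
    hence "qf Q x \<le> cQ * Rx\<^sup>2" "qf R v \<le> cR * Ru\<^sup>2"
      using abs_le_D1[OF cQ(1)[of x]] abs_le_D1[OF cR(1)[of v]] by linarith+
    ultimately show ?thesis using eps_pos unfolding stage_cost_def by (simp add: add_mono)
  qed
  thus ?thesis by blast
qed

lemma terminal_cost_bounded_of_slack:
  assumes m: "0 < m"
  shows "\<exists>T. \<forall>\<delta> x. \<delta> < m \<longrightarrow> norm x \<le> Rx \<longrightarrow> m \<le> 1 - \<phi> x \<longrightarrow> terminal_cost \<delta> x \<le> T"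
proof -
  obtain cP where cP: "\<And>x. \<bar>qf P x\<bar> \<le> cP * (norm x)\<^sup>2" "0 \<le> cP"
    using qf_abs_le_norm_sq[of P] by metis
  have "terminal_cost \<delta> x \<le> cP * Rx\<^sup>2 + \<epsilon> * \<bar>ln m\<bar>"
    if d: "\<delta> < m" and x: "norm x \<le> Rx" and sf: "m \<le> 1 - \<phi> x" for \<delta> x
  proof -
    have "ln m \<le> ln (1 - \<phi> x)" using sf m by simp
    moreover have "Bhat r \<delta> (1 - \<phi> x) = - ln (1 - \<phi> x)" using sf d by (intro Bhat_eq_minus_ln) linarith
    ultimately have "\<epsilon> * Bhat r \<delta> (1 - \<phi> x) \<le> \<epsilon> * \<bar>ln m\<bar>" using eps_pos by (intro mult_left_mono) auto
    moreover have "cP * (norm x)\<^sup>2 \<le> cP * Rx\<^sup>2" using x cP(2) by (intro mult_left_mono power_mono) simp_all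
    hence "qf P x \<le> cP * Rx\<^sup>2" using abs_le_D1[OF cP(1)[of x]] by linarith
    ultimately show ?thesis unfolding terminal_cost_def by linarith
  qed
  thus ?thesis by blast
qed

lemma relaxed_cost_bounded_of_slack:
  assumes m: "0 < m"
  shows "\<exists>C. \<forall>\<delta> x u. \<delta> < m \<longrightarrow> norm x \<le> Rx \<longrightarrow> (\<forall>k<N. norm (u k) \<le> Ru)
      \<longrightarrow> (\<forall>k<N. \<forall>i. m \<le> dx $ i - Cx $ i \<bullet> pred A B x u k) \<longrightarrow> (\<forall>k<N. \<forall>j. m \<le> du $ j - Cu $ j \<bullet> u k)
      \<longrightarrow> m \<le> 1 - \<phi> (pred A B x u N) \<longrightarrow> J \<delta> x u \<le> C"
proof -
  obtain c where c: "0 \<le> c" "\<And>x u k. k \<le> N \<Longrightarrow> norm (pred A B x u k) \<le> c * (norm x + (\<Sum>j<N. norm (u j)))"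
    using pred_norm_bound[where A=A and B=B and N=N] by blast
  define Rp where "Rp = c * (Rx + real N * Ru)"
  obtain S where S: "\<forall>\<delta> x v. \<delta> < m \<longrightarrow> norm x \<le> Rp \<longrightarrow> norm v \<le> Ru
      \<longrightarrow> (\<forall>i. m \<le> dx $ i - Cx $ i \<bullet> x) \<longrightarrow> (\<forall>j. m \<le> du $ j - Cu $ j \<bullet> v) \<longrightarrow> stage_cost \<delta> x v \<le> S"
    using stage_cost_bounded_of_slack[OF m] by blast
  obtain T where T: "\<forall>\<delta> x. \<delta> < m \<longrightarrow> norm x \<le> Rp \<longrightarrow> m \<le> 1 - \<phi> x \<longrightarrow> terminal_cost \<delta> x \<le> T"
    using terminal_cost_bounded_of_slack[OF m] by blast
  have "J \<delta> x u \<le> real N * S + T"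
    if d: "\<delta> < m" and x: "norm x \<le> Rx" and u: "\<forall>k<N. norm (u k) \<le> Ru"
      and sx: "\<forall>k<N. \<forall>i. m \<le> dx $ i - Cx $ i \<bullet> pred A B x u k"
      and su: "\<forall>k<N. \<forall>j. m \<le> du $ j - Cu $ j \<bullet> u k"
      and sf: "m \<le> 1 - \<phi> (pred A B x u N)" for \<delta> x u
  proof -
    have p: "norm (pred A B x u k) \<le> Rp" if "k \<le> N" for k
    proof -
      have "(\<Sum>j<N. norm (u j)) \<le> real N * Ru" using sum_bounded_above[of "{..<N}" "\<lambda>j. norm (u j)" Ru] u by simp
      hence "c * (norm x + (\<Sum>j<N. norm (u j))) \<le> Rp" unfolding Rp_def using x c(1) by (intro mult_left_mono) auto
      thus ?thesis using c(2)[OF that, of x u] by linarith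
    qed
    have "(\<Sum>k<N. stage_cost \<delta> (pred A B x u k) (u k)) \<le> real N * S"
      using sum_bounded_above[of "{..<N}" "\<lambda>k. stage_cost \<delta> (pred A B x u k) (u k)" S] S d p u sx su by simp
    moreover have "terminal_cost \<delta> (pred A B x u N) \<le> T" using T d p[of N] sf by simp
    ultimately show ?thesis unfolding relaxed_cost_eq_sum by linarith
  qed
  thus ?thesis by blast
qed

lemma uniform_cost_bound_on_compact:
  assumes X0: "compact X0"
    and X0_sub: "X0 \<subseteq> interior (feasible_set A B (polytope_set Cx dx) (polytope_set Cu du) {x. \<phi> x \<le> 1} N)"
  shows "\<exists>C. \<forall>\<^sub>F \<delta> in at_right 0. \<forall>x\<in>X0. \<exists>u. J \<delta> x u \<le> C"
proof -
  obtain t where t: "0 < t" "\<And>x. x \<in> X0 \<Longrightarrow> (1 + t) *\<^sub>R x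
      \<in> interior (feasible_set A B (polytope_set Cx dx) (polytope_set Cu du) {x. \<phi> x \<le> 1} N)"
    using compact_subset_open_scaleR[OF X0 open_interior X0_sub] by blast
  define s where "s = 1 / (1 + t)"
  have s: "0 < s" "s < 1" using t(1) by (auto simp: s_def)
  define dmin where "dmin = Min (insert 1 (range (\<lambda>i. dx $ i) \<union> range (\<lambda>j. du $ j)))"
  have dmin: "dmin \<le> 1" "\<And>i. dmin \<le> dx $ i" "\<And>j. dmin \<le> du $ j"
    unfolding dmin_def by (rule Min_le; simp)+
  have "dmin \<in> insert 1 (range (\<lambda>i. dx $ i) \<union> range (\<lambda>j. du $ j))"
    unfolding dmin_def by (rule Min_in) auto
  hence "0 < dmin" using dx_pos du_pos by auto
  define m where "m = (1 - s) * dmin"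
  have m: "0 < m" using s \<open>0 < dmin\<close> by (simp add: m_def)
  obtain Rx where Rx: "\<And>x. x \<in> X0 \<Longrightarrow> norm x \<le> Rx"
    using compact_imp_bounded[OF X0] unfolding bounded_pos by blast
  obtain Ru where Ru: "0 < Ru" "\<And>v. v \<in> polytope_set Cu du \<Longrightarrow> norm v \<le> Ru"
    using compact_imp_bounded[OF U_compact] unfolding bounded_pos by blast
  obtain C where C: "\<And>\<delta> x u. \<delta> < m \<Longrightarrow> norm x \<le> Rx \<Longrightarrow> (\<forall>k<N. norm (u k) \<le> Ru)
      \<Longrightarrow> (\<forall>k<N. \<forall>i. m \<le> dx $ i - Cx $ i \<bullet> pred A B x u k) \<Longrightarrow> (\<forall>k<N. \<forall>j. m \<le> du $ j - Cu $ j \<bullet> u k)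
      \<Longrightarrow> m \<le> 1 - \<phi> (pred A B x u N) \<Longrightarrow> J \<delta> x u \<le> C"
    using relaxed_cost_bounded_of_slack[OF m, of Rx Ru] by blast
  have "\<exists>u. J \<delta> x u \<le> C" if d: "\<delta> < m" and x: "x \<in> X0" for \<delta> x
  proof -
    have x_eq: "s *\<^sub>R ((1 + t) *\<^sub>R x) = x" using t(1) by (simp add: s_def)
    obtain u where u: "\<And>k. k < N \<Longrightarrow> \<exists>v\<in>polytope_set Cu du. u k = s *\<^sub>R v"
      "\<And>k i. k < N \<Longrightarrow> (1 - s) * dx $ i \<le> dx $ i - Cx $ i \<bullet> pred A B x u k"
      "\<And>k j. k < N \<Longrightarrow> (1 - s) * du $ j \<le> du $ j - Cu $ j \<bullet> u k"
      "1 - s \<le> 1 - \<phi> (pred A B x u N)"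
      using scaled_feasible_input[OF interior_subset[THEN subsetD, OF t(2)[OF x]], of s] s
      unfolding x_eq by auto
    have "norm (u k) \<le> Ru" if k: "k < N" for k
    proof -
      obtain v where v: "v \<in> polytope_set Cu du" "u k = s *\<^sub>R v" using u(1)[OF k] by blast
      have "s * norm v \<le> 1 * Ru" using Ru(2)[OF v(1)] s by (intro mult_mono) auto
      thus ?thesis using v(2) s by simp
    qed
    moreover have "m \<le> (1 - s) * dx $ i" "m \<le> (1 - s) * du $ j" "m \<le> 1 - s" for i j
      using s dmin unfolding m_def by (auto intro: mult_left_mono mult_left_le)
    ultimately show ?thesis using u Rx[OF x] d by (intro exI[of _ u] C) (auto intro: order_trans[OF _ u(2)] order_trans[OF _ u(3)])
  qed
  moreover have "\<forall>\<^sub>F \<delta> in at_right 0. \<delta> < m" using m by (auto simp: eventually_at_right_field)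
  ultimately have "\<forall>\<^sub>F \<delta> in at_right 0. \<forall>x\<in>X0. \<exists>u. J \<delta> x u \<le> C"
    by (auto elim: eventually_mono)
  thus ?thesis ..
qed

section \<open>Stability of the closed loop\<close>

lemma eventually_terminal_value_small:
  assumes "0 < v"
  shows "\<forall>\<^sub>F x in nhds 0. \<phi> x < 1/2 \<and> qf P x - \<epsilon> * ln (1 - \<phi> x) < v"
proof -
  have "isCont \<phi> 0" using phi_cont by (simp add: continuous_on_eq_continuous_at)
  hence \<phi>: "(\<phi> \<longlongrightarrow> 0) (nhds 0)" using isCont_tendsto_compose[OF _ filterlim_ident] phi_0 by fastforce
  have "isCont (qf P) 0" using continuous_on_qf[of UNIV P] by (simp add: continuous_on_eq_continuous_at)
  hence "(qf P \<longlongrightarrow> 0) (nhds 0)" using isCont_tendsto_compose[OF _ filterlim_ident] by (fastforce simp: qf_def)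
  hence "((\<lambda>x. qf P x - \<epsilon> * ln (1 - \<phi> x)) \<longlongrightarrow> 0 - \<epsilon> * ln (1 - 0)) (nhds 0)"
    using \<phi> by (intro tendsto_intros) auto
  thus ?thesis
    using order_tendstoD(2)[OF \<phi>, of "1/2"] order_tendstoD(2)[of _ 0 _ v] assms
    by (intro eventually_conj) auto
qed

lemma closed_loop_stable:
  assumes small: "small_delta \<delta>" and level: "1 < unrelaxed_level \<delta>"
  shows "\<forall>e>0. \<exists>\<eta>>0. \<forall>xs us. closed_loop A B (J \<delta>) xs us \<and> norm (xs 0) < \<eta> \<longrightarrow> (\<forall>k. norm (xs k) < e)"
proof (intro allI impI)
  fix e :: real assume e: "0 < e"
  obtain c1 c2 where c: "0 \<le> c1" "0 \<le> c2" and bound: "\<forall>\<delta> xs us k. small_delta \<delta> \<and> closed_loop A B (J \<delta>) xs us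
      \<and> J \<delta> (xs 0) (us 0) < unrelaxed_level \<delta> \<longrightarrow> norm (xs k) \<le> c1 * norm (xs 0) + c2 * sqrt (J \<delta> (xs 0) (us 0))"
    using closed_loop_state_bound by blast
  define v where "v = min 1 ((e / (2 * (c2 + 1)))\<^sup>2)"
  have v: "0 < v" "v \<le> 1" using e c(2) by (auto simp: v_def)
  have "sqrt v \<le> sqrt ((e / (2 * (c2 + 1)))\<^sup>2)" unfolding real_sqrt_le_iff v_def by simp
  hence "c2 * sqrt v \<le> c2 * (e / (2 * (c2 + 1)))"
    using e c(2) by (intro mult_left_mono) auto
  also have "\<dots> < e / 2" using e c(2) by (simp add: field_simps)
  finally have c2v: "c2 * sqrt v < e / 2" .
  have "((\<lambda>x. c1 * norm x) \<longlongrightarrow> 0) (nhds (0::real^'n))"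
    by (rule tendsto_mult_right_zero[OF tendsto_norm_zero[OF filterlim_ident]])
  hence "\<forall>\<^sub>F x in nhds 0. (\<phi> x < 1/2 \<and> qf P x - \<epsilon> * ln (1 - \<phi> x) < v) \<and> c1 * norm x < e / 2"
    using e by (intro eventually_conj[OF eventually_terminal_value_small[OF v(1)]] order_tendstoD(2)) auto
  then obtain \<eta> where \<eta>: "0 < \<eta>" "\<And>x. norm x < \<eta>
      \<Longrightarrow> (\<phi> x < 1/2 \<and> qf P x - \<epsilon> * ln (1 - \<phi> x) < v) \<and> c1 * norm x < e / 2"
    by (auto simp: eventually_nhds_metric dist_norm)
  have "norm (xs k) < e" if cl: "closed_loop A B (J \<delta>) xs us" and x0: "norm (xs 0) < \<eta>" for xs us k
  proof -
    note x0 = \<eta>(2)[OF x0]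
    \<comment> \<open>Near the origin the feedback \<open>K\<close> is feasible, so the optimal cost is small.\<close>
    have "J \<delta> (xs 0) (us 0) \<le> J \<delta> (xs 0) (\<lambda>j. K *v ((((*v) AK) ^^ j) (xs 0)))"
      by (rule closed_loopD(1)[OF cl])
    also have "\<dots> \<le> terminal_cost \<delta> (xs 0)" using x0 by (intro relaxed_cost_feedback_le[OF small]) simp
    also have "\<dots> = qf P (xs 0) - \<epsilon> * ln (1 - \<phi> (xs 0))"
      using x0 small by (simp add: terminal_cost_def small_delta_def Bhat_eq_minus_ln)
    finally have J0: "J \<delta> (xs 0) (us 0) < v" using x0 by linarith
    hence "norm (xs k) \<le> c1 * norm (xs 0) + c2 * sqrt (J \<delta> (xs 0) (us 0))"
      using bound small cl v(2) level by auto
    also have "c2 * sqrt (J \<delta> (xs 0) (us 0)) \<le> c2 * sqrt v"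
      using J0 c(2) by (intro mult_left_mono) auto
    finally show ?thesis using x0 c2v by linarith
  qed
  with \<eta>(1) show "\<exists>\<eta>>0. \<forall>xs us. closed_loop A B (J \<delta>) xs us \<and> norm (xs 0) < \<eta> \<longrightarrow> (\<forall>k. norm (xs k) < e)"
    by blast
qed

theorem relaxed_mpc_asymptotically_stable:
  assumes X0: "compact X0"
    and X0_sub: "X0 \<subseteq> interior (feasible_set A B (polytope_set Cx dx) (polytope_set Cu du) {x. \<phi> x \<le> 1} N)"
  shows "\<exists>\<delta>0>0. \<forall>\<delta>. admissible r Cx dx rcx Cu du rcu \<delta> \<and> \<delta> \<le> \<delta>0 \<longrightarrow>
      (let J = relaxed_cost A B Q R \<epsilon> N r \<delta> Cx dx rcx Cu du rcu P \<phi> in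
        (\<forall>e>0. \<exists>\<eta>>0. \<forall>xs us. closed_loop A B J xs us \<and> norm (xs 0) < \<eta> \<longrightarrow>
                          (\<forall>k. norm (xs k) < e)) \<and>
        (\<forall>xs us. closed_loop A B J xs us \<and> xs 0 \<in> X0 \<longrightarrow>
           xs \<longlonglongrightarrow> 0 \<and>
           (\<forall>k. strictly_in Cx dx (xs k) \<and> strictly_in Cu du (us k 0))))"
proof -
  obtain C where "\<forall>\<^sub>F \<delta> in at_right 0. \<forall>x\<in>X0. \<exists>u. J \<delta> x u \<le> C"
    using uniform_cost_bound_on_compact[OF X0 X0_sub] by blast
  hence "\<forall>\<^sub>F \<delta> in at_right 0. small_delta \<delta> \<and> max C 1 < unrelaxed_level \<delta> \<and> (\<forall>x\<in>X0. \<exists>u. J \<delta> x u \<le> C)"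
    by (intro eventually_conj eventually_small_delta eventually_unrelaxed_level_gt)
  then obtain b where b: "0 < b" "\<And>\<delta>. 0 < \<delta> \<Longrightarrow> \<delta> < b
      \<Longrightarrow> small_delta \<delta> \<and> max C 1 < unrelaxed_level \<delta> \<and> (\<forall>x\<in>X0. \<exists>u. J \<delta> x u \<le> C)"
    by (auto simp: eventually_at_right_field)
  have "(\<forall>e>0. \<exists>\<eta>>0. \<forall>xs us. closed_loop A B (J \<delta>) xs us \<and> norm (xs 0) < \<eta> \<longrightarrow> (\<forall>k. norm (xs k) < e))
      \<and> (\<forall>xs us. closed_loop A B (J \<delta>) xs us \<and> xs 0 \<in> X0 \<longrightarrow>
           xs \<longlonglongrightarrow> 0 \<and> (\<forall>k. strictly_in Cx dx (xs k) \<and> strictly_in Cu du (us k 0)))"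
    if "admissible r Cx dx rcx Cu du rcu \<delta>" "\<delta> \<le> b / 2" for \<delta>
  proof -
    have \<delta>: "small_delta \<delta>" "max C 1 < unrelaxed_level \<delta>" "\<forall>x\<in>X0. \<exists>u. J \<delta> x u \<le> C"
      using b that by (simp_all add: admissible_def)
    have "J \<delta> (xs 0) (us 0) < unrelaxed_level \<delta>" if "closed_loop A B (J \<delta>) xs us" "xs 0 \<in> X0" for xs us
      using \<delta>(2,3) closed_loopD(1)[OF that(1)] that(2) by (smt (verit))
    thus ?thesis
      using closed_loop_stable[OF \<delta>(1)] \<delta>(2) closed_loop_tendsto_0[OF \<delta>(1)]
        closed_loop_strictly_feasible[OF \<delta>(1)] by auto
  qed
  moreover have "0 < b / 2" using b(1) by simp
  ultimately show ?thesis unfolding Let_def by blast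
qed

end

theorem corollary1:
  fixes A :: "real^'n^'n" and B :: "real^'m^'n"
    and Cx :: "real^'n^'p" and dx :: "real^'p"
    and Cu :: "real^'m^'q" and du :: "real^'q"
    and Q :: "real^'n^'n" and R :: "real^'m^'m"
    and N :: nat and \<epsilon> :: real
    and r :: relax_kind and rcx :: "'p recenter" and rcu :: "'q recenter"
    and K :: "real^'n^'m" and M :: "real^'n^'n" and NN :: "(real^'n) set"
    and P :: "real^'n^'n"
    and \<phi> :: "real^'n \<Rightarrow> real" and Bf :: "real^'n \<Rightarrow> real"
  defines "X \<equiv> polytope_set Cx dx"
    and "U \<equiv> polytope_set Cu du"
    and "AK \<equiv> A + B ** K"
    and "Xf \<equiv> {x. \<phi> x \<le> 1}"
  assumes stab: "stabilizable A B"
    and U_compact: "compact U"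
    and dx_pos: "\<forall>i. 0 < dx $ i" and du_pos: "\<forall>j. 0 < du $ j"
    and Q_psd: "psd Q" and R_pd: "pd R"
    and N_pos: "1 \<le> N" and eps_pos: "0 < \<epsilon>"
    and r_valid: "valid_relax r"
    and rcx_valid: "valid_recenter Cx dx rcx" and rcu_valid: "valid_recenter Cu du rcu"
    and K_schur: "schur AK"
    and M_psd: "psd M"
    and NN_convex: "convex NN" and NN_compact: "compact NN"
    and NN_sub: "NN \<subseteq> {x \<in> X. K *v x \<in> U}"
    and NN_int: "0 \<in> interior NN"
    and NN_bound: "\<forall>x\<in>NN. strictly_in Cx dx x \<and> strictly_in Cu du (K *v x) \<and>
                      log_barrier Cx dx rcx x + log_barrier Cu du rcu (K *v x) \<le> qf M x"
    and P_pd: "pd P"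
    and P_lyap: "P = transpose AK ** P ** AK + transpose K ** R ** K + Q + \<epsilon> *\<^sub>R M"
    and phi_C1: "\<exists>g. (\<forall>x. (\<phi> has_derivative (\<lambda>h. g x \<bullet> h)) (at x)) \<and> continuous_on UNIV g"
    and phi_convex: "convex_on UNIV \<phi>"
    and phi_posdef: "\<phi> 0 = 0" "\<forall>x. x \<noteq> 0 \<longrightarrow> 0 < \<phi> x"
    and phi_dec: "\<forall>x\<in>Xf. \<phi> (AK *v x) \<le> \<phi> x"
    and Xf_convex: "convex Xf" and Xf_compact: "compact Xf"
    and Xf_sub: "0 \<in> Xf" "Xf \<subseteq> NN"
    and Xf_inv: "\<forall>x\<in>Xf. AK *v x \<in> Xf"
    and Bf_convex: "convex_on (interior Xf) Bf"
    and Bf_nonneg: "\<forall>x\<in>interior Xf. 0 \<le> Bf x"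
    and Bf_zero: "Bf 0 = 0"
    and Bf_boundary: "\<forall>y\<in>frontier Xf. filterlim Bf at_top (at y within interior Xf)"
    and Bf_dec: "\<forall>x\<in>interior Xf. Bf (AK *v x) \<le> Bf x"
  shows "\<forall>X0. compact X0 \<and> X0 \<subseteq> interior (feasible_set A B X U Xf N) \<longrightarrow>
    (\<exists>\<delta>0>0. \<forall>\<delta>. admissible r Cx dx rcx Cu du rcu \<delta> \<and> \<delta> \<le> \<delta>0 \<longrightarrow>
      (let J = relaxed_cost A B Q R \<epsilon> N r \<delta> Cx dx rcx Cu du rcu P \<phi> in
        (\<forall>e>0. \<exists>\<eta>>0. \<forall>xs us. closed_loop A B J xs us \<and> norm (xs 0) < \<eta> \<longrightarrow>
                          (\<forall>k. norm (xs k) < e)) \<and>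
        (\<forall>xs us. closed_loop A B J xs us \<and> xs 0 \<in> X0 \<longrightarrow>
           xs \<longlonglongrightarrow> 0 \<and>
           (\<forall>k. strictly_in Cx dx (xs k) \<and> strictly_in Cu du (us k 0)))))"
proof -
  obtain g where "\<And>x. (\<phi> has_derivative (\<lambda>h. g x \<bullet> h)) (at x)" using phi_C1 by blast
  hence "continuous_on UNIV \<phi>"
    using has_derivative_continuous continuous_at_imp_continuous_on by blast
  then interpret relaxed_mpc A B Cx dx Cu du Q R N \<epsilon> r rcx rcu K M NN P \<phi>
    using dx_pos du_pos U_compact Q_psd R_pd N_pos eps_pos r_valid rcx_valid rcu_valid K_schur
      NN_compact NN_bound P_pd P_lyap phi_convex phi_posdef phi_dec Xf_sub(2)
    by unfold_locales (auto simp: X_def U_def AK_def Xf_def)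
  show ?thesis
    using relaxed_mpc_asymptotically_stable unfolding X_def U_def Xf_def by blast
qed

end
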